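(* For any $\varepsilon > 0$, there is a randomized algorithm satisfying the following: its input consists of a matroid $\mathcal{M} = (V, \mathcal{I})$ of rank $r$ given as an independence oracle and a point $x$ in the base polytope $B(\mathcal{M})$ represented as a convex combination $x = \sum_{i=1}^t \beta_i \mathbf{1}_{B_i}$ of (characteristic vectors of) $t$ bases $B_1,\dots,B_t$ of $\mathcal{M}$; its output is a basis $S$ of $\mathcal{M}$ such that $\mathbb{E}[f(S)] \ge (1-\varepsilon) F(x)$ for every submodular function $f \colon 2^V \to \mathbb{R}$ with multilinear extension $F$; and it uses $O\!\left(r^{3/2} t \log^{3/2}\!\left(\frac{rt}{\varepsilon}\right)\right)$ independence oracle queries.
   Context: For $A\subseteq V$, $\mathbf{1}_A \in\{0,1\}^V$ is its characteristic vector. The base polytope $B(\mathcal{M})$ is the convex hull of the characteristic vectors of all bases (maximal independent sets) of $\mathcal{M}$. The multilinear extension of $f$ is $F(x) = \sum_{S\subseteq V} f(S)\prod_{v\in S}x_v\prod_{v\in V\setminus S}(1-x_v)$ for $x\in[0,1]^V$, i.e. $\mathbb{E}[f(R(x))]$ where $R(x)$ contains each $v$ independently with probability $x_v$. An independence oracle answers, for a queried $S\subseteq V$, whether $S\in\mathcal{I}$. Convex combination means $\beta_i \ge 0$ and $\sum_i \beta_i = 1$.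
   Formalization: The submodular function f is assumed nonnegative on all subsets of V; for arbitrary real-valued f the claim is false (for f constantly −1 it would require −1 ≥ −(1−ε)). *)

theory Defs
  imports "HOL-Probability.Probability" "HOL-Library.Function_Algebras"
begin

text \<open>
  Vectors indexed by the ground set are functions \<open>'a \<Rightarrow> real\<close> (vanishing outside the ground set);
  the pointwise vector space structure makes \<^term>\<open>(hull)\<close> and scalar multiplication available.
\<close>

instantiation "fun" :: (type, real_vector) real_vector
begin

definition scaleR_fun :: "real \<Rightarrow> ('a \<Rightarrow> 'b) \<Rightarrow> 'a \<Rightarrow> 'b" where
  "scaleR_fun c f = (\<lambda>v. c *\<^sub>R f v)"

instance
  by standard (simp_all add: scaleR_fun_def fun_eq_iff scaleR_add_right scaleR_add_left)

end

definition matroid :: "'a set \<Rightarrow> 'a set set \<Rightarrow> bool" where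
  "matroid V \<I> \<longleftrightarrow>
     finite V \<and> \<I> \<subseteq> Pow V \<and> {} \<in> \<I> \<and>
     (\<forall>X\<in>\<I>. \<forall>Y. Y \<subseteq> X \<longrightarrow> Y \<in> \<I>) \<and>
     (\<forall>X\<in>\<I>. \<forall>Y\<in>\<I>. card X < card Y \<longrightarrow> (\<exists>y\<in>Y - X. insert y X \<in> \<I>))"

definition basis :: "'a set set \<Rightarrow> 'a set \<Rightarrow> bool" where
  "basis \<I> B \<longleftrightarrow> B \<in> \<I> \<and> (\<forall>X\<in>\<I>. B \<subseteq> X \<longrightarrow> X = B)"

definition matroid_rank :: "'a set set \<Rightarrow> nat" where
  "matroid_rank \<I> = Max (card ` \<I>)"

definition base_polytope :: "'a set set \<Rightarrow> ('a \<Rightarrow> real) set" where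
  "base_polytope \<I> = convex hull (indicator ` {B. basis \<I> B})"

definition submodular_on :: "'a set \<Rightarrow> ('a set \<Rightarrow> real) \<Rightarrow> bool" where
  "submodular_on V f \<longleftrightarrow> (\<forall>X Y. X \<subseteq> V \<longrightarrow> Y \<subseteq> V \<longrightarrow> f (X \<union> Y) + f (X \<inter> Y) \<le> f X + f Y)"

definition multilinear_extension :: "'a set \<Rightarrow> ('a set \<Rightarrow> real) \<Rightarrow> ('a \<Rightarrow> real) \<Rightarrow> real" where
  "multilinear_extension V f x = (\<Sum>S\<in>Pow V. f S * (\<Prod>v\<in>S. x v) * (\<Prod>v\<in>V - S. 1 - x v))"

text \<open>
  A randomized algorithm with access to an independence oracle on subsets of \<open>'a\<close> and result type
  \<open>'r\<close>. The only access to the oracle is through \<open>Query\<close>, whose continuation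
  receives the answer; \<open>Sample\<close> draws a fresh number, independently of all earlier draws.
  The type is inductive, so every run terminates.
\<close>

datatype ('a, 'r) oracle_alg =
    Return 'r
  | Query "'a set" "bool \<Rightarrow> ('a, 'r) oracle_alg"
  | Sample "nat pmf" "nat \<Rightarrow> ('a, 'r) oracle_alg"

text \<open>Joint distribution of the result and of the number of queries made.\<close>

primrec run :: "('a set \<Rightarrow> bool) \<Rightarrow> ('a, 'r) oracle_alg \<Rightarrow> ('r \<times> nat) pmf" where
  "run orc (Return a) = return_pmf (a, 0)"
| "run orc (Query S k) = map_pmf (\<lambda>(a, q). (a, Suc q)) (run orc (k (orc S)))"
| "run orc (Sample p k) = bind_pmf p (\<lambda>n. run orc (k n))"

end

theory Submission
  imports Defs
begin

text \<open>
  The bases are merged pairwise. For two bases \<open>B\<close>, \<open>B'\<close> draw an arc from \<open>w\<close> to \<open>u\<close> if the basis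
  lacking \<open>w\<close> remains a basis after replacing \<open>u\<close> by \<open>w\<close>. Given a directed cycle of arbitrary length,
  swap along a single random arc of it: the expected displacement of the point is a telescoping sum
  and vanishes, so, the multilinear extension being convex in the directions \<open>e\<^sub>w - e\<^sub>u\<close>, its expected
  value does not drop, while \<open>|B - B'|\<close> decreases by one.

  A cycle is found with about \<open>sqrt r\<close> binary searches. A random set of about \<open>sqrt r\<close> vertices meets,
  up to a small failure probability, every out-neighbourhood of size at least about \<open>sqrt r\<close>. Hence
  either each sampled vertex has a successor in the sample, which gives a cycle inside the sample, or
  some vertex has so few successors that all of them can be tested for a 2-cycle, which exists by
  symmetric exchange. Failures cost only a factor \<open>1 - \<epsilon>\<close> in total because \<open>f\<close> is nonnegative.
\<close>

section \<open>Matroid bases and exchange properties\<close>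

lemma matroid_subset: "matroid V \<I> \<Longrightarrow> X \<in> \<I> \<Longrightarrow> Y \<subseteq> X \<Longrightarrow> Y \<in> \<I>"
  by (auto simp: matroid_def)

lemma matroid_carrier: "matroid V \<I> \<Longrightarrow> X \<in> \<I> \<Longrightarrow> X \<subseteq> V"
  by (auto simp: matroid_def)

lemma matroid_finite: "matroid V \<I> \<Longrightarrow> X \<in> \<I> \<Longrightarrow> finite X"
  by (meson finite_subset matroid_carrier matroid_def)

lemma matroid_augment:
  "matroid V \<I> \<Longrightarrow> X \<in> \<I> \<Longrightarrow> Y \<in> \<I> \<Longrightarrow> card X < card Y \<Longrightarrow> \<exists>y\<in>Y - X. insert y X \<in> \<I>"
  by (simp add: matroid_def)

lemma basis_indep: "basis \<I> B \<Longrightarrow> B \<in> \<I>"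
  by (simp add: basis_def)

lemma matroid_extend:
  assumes M: "matroid V \<I>" and "X \<in> \<I>" "Y \<in> \<I>" "card X \<le> card Y"
  shows "\<exists>Z\<in>\<I>. X \<subseteq> Z \<and> Z \<subseteq> X \<union> Y \<and> card Z = card Y"
  using assms(2-)
proof (induction "card Y - card X" arbitrary: X)
  case 0
  then show ?case by auto
next
  case (Suc n)
  then obtain y where y: "y \<in> Y - X" "insert y X \<in> \<I>"
    using matroid_augment[OF M, of X Y] by (metis zero_less_Suc zero_less_diff)
  have "card (insert y X) = Suc (card X)"
    using y matroid_finite[OF M \<open>X \<in> \<I>\<close>] by simp
  with Suc y have "\<exists>Z\<in>\<I>. insert y X \<subseteq> Z \<and> Z \<subseteq> insert y X \<union> Y \<and> card Z = card Y"
    by (intro Suc.hyps(1)) auto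
  with y show ?case by auto
qed

lemma card_le_basis:
  assumes M: "matroid V \<I>" and B: "basis \<I> B" and X: "X \<in> \<I>"
  shows "card X \<le> card B"
proof (rule ccontr)
  assume "\<not> card X \<le> card B"
  then obtain y where "y \<in> X - B" "insert y B \<in> \<I>"
    using matroid_augment[OF M basis_indep[OF B] X] by auto
  with B show False by (auto simp: basis_def)
qed

lemma basis_if_card:
  assumes M: "matroid V \<I>" and B: "basis \<I> B" and X: "X \<in> \<I>" and "card X = card B"
  shows "basis \<I> X"
  unfolding basis_def
proof (intro conjI ballI impI)
  fix Y assume "Y \<in> \<I>" "X \<subseteq> Y"
  with assms show "Y = X"
    by (metis card_le_basis card_seteq matroid_finite)
qed (fact X)

lemma card_basis_eq:
  "matroid V \<I> \<Longrightarrow> basis \<I> B \<Longrightarrow> basis \<I> B' \<Longrightarrow> card B = card B'"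
  by (meson basis_indep card_le_basis le_antisym)

lemma matroid_rank_eq_card:
  assumes M: "matroid V \<I>" and B: "basis \<I> B"
  shows "matroid_rank \<I> = card B"
  unfolding matroid_rank_def
proof (rule Max_eqI)
  have "finite \<I>" using M by (metis finite_Pow_iff finite_subset matroid_def)
  then show "finite (card ` \<I>)" by simp
qed (use card_le_basis[OF M B] basis_indep[OF B] in auto)

text \<open>The set \<open>insert w B - A\<close> extends to size \<open>card B\<close> inside
  \<open>insert w B\<close>; the extension omits a single element, which lies in \<open>A\<close>.
  Thus one query tests a whole set of candidates, which makes binary search possible.\<close>

lemma basis_exchange:
  assumes M: "matroid V \<I>" and B: "basis \<I> B" and w: "w \<notin> B" and A: "A \<subseteq> B"
    and ind: "insert w B - A \<in> \<I>"
  shows "\<exists>a\<in>A. insert w B - {a} \<in> \<I>"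
proof -
  obtain Z where Z: "Z \<in> \<I>" "insert w B - A \<subseteq> Z" "Z \<subseteq> (insert w B - A) \<union> B" "card Z = card B"
    using matroid_extend[OF M ind basis_indep[OF B] card_le_basis[OF M B ind]] by auto
  have fin: "finite B" using matroid_finite[OF M basis_indep[OF B]] .
  have "Z \<subseteq> insert w B" using Z A by auto
  then have "card (insert w B - Z) = 1"
    using fin w Z(4) by (subst card_Diff_subset) (auto intro: finite_subset)
  then obtain a where a: "insert w B - Z = {a}" by (auto simp: card_1_singleton_iff)
  then have "a \<in> A" using Z(2) w A by auto
  moreover have "insert w B - {a} = Z" using a \<open>Z \<subseteq> insert w B\<close> by auto
  ultimately show ?thesis using Z(1) by auto
qed

lemma basis_exchange_iff:
  assumes M: "matroid V \<I>" and B: "basis \<I> B" and w: "w \<notin> B" and A: "A \<subseteq> B"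
  shows "insert w B - A \<in> \<I> \<longleftrightarrow> (\<exists>a\<in>A. insert w B - {a} \<in> \<I>)"
  using basis_exchange[OF assms] by (auto intro: matroid_subset[OF M])

text \<open>Suppose no such \<open>u\<close> exists. Then all elements of \<open>B\<close>
  exchangeable for \<open>w\<close> lie in the span of \<open>B' - {w}\<close>. As \<open>w\<close>
  does not, adding \<open>w\<close> to them keeps them independent, although together with
  \<open>w\<close> they form a circuit.\<close>

lemma basis_symmetric_exchange:
  assumes M: "matroid V \<I>" and B: "basis \<I> B" and B': "basis \<I> B'" and w: "w \<in> B' - B"
  shows "\<exists>u\<in>B - B'. insert w B - {u} \<in> \<I> \<and> insert u B' - {w} \<in> \<I>"
proof (rule ccontr)
  assume neg: "\<not> ?thesis"
  \<comment> \<open>\<open>insert w K\<close> is the fundamental circuit of \<open>w\<close> in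
    \<open>B\<close>.\<close>
  define K where "K = {u\<in>B. insert w B - {u} \<in> \<I>}"
  have KI: "K \<in> \<I>" and B'I: "B' - {w} \<in> \<I>"
    using M basis_indep[OF B] basis_indep[OF B'] by (auto simp: K_def intro: matroid_subset)
  have fin: "finite B'" using matroid_finite[OF M basis_indep[OF B']] .
  have small: "card Y \<le> card (B' - {w})" if Y: "Y \<in> \<I>" "Y \<subseteq> K \<union> (B' - {w})" for Y
  proof (rule ccontr)
    assume "\<not> ?thesis"
    then obtain y where y: "y \<in> Y - (B' - {w})" "insert y (B' - {w}) \<in> \<I>"
      using matroid_augment[OF M B'I Y(1)] by auto
    have "y \<noteq> w" using y(1) Y(2) w by (auto simp: K_def)
    then have "y \<in> B - B'" "insert w B - {y} \<in> \<I>" using y(1) Y(2) by (auto simp: K_def)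
    moreover have "insert y B' - {w} \<in> \<I>" using y(2) \<open>y \<noteq> w\<close> by (simp add: insert_Diff_if)
    ultimately show False using neg by blast
  qed
  obtain Y where Y: "Y \<in> \<I>" "K \<subseteq> Y" "Y \<subseteq> K \<union> (B' - {w})" "card Y = card (B' - {w})"
    using matroid_extend[OF M KI B'I small] KI by auto
  have "card Y < card B'" using Y(4) w fin by (metis DiffD1 card_Diff1_less)
  then obtain y where y: "y \<in> B' - Y" "insert y Y \<in> \<I>"
    using matroid_augment[OF M Y(1) basis_indep[OF B']] by auto
  \<comment> \<open>\<open>Y\<close> already has the largest size possible inside
    \<open>K \<union> (B' - {w})\<close>, so only \<open>w\<close> can enlarge it.\<close>
  have "y = w"
  proof (rule ccontr)
    assume "y \<noteq> w"
    then have "card (insert y Y) \<le> card Y" using small[OF y(2)] Y y by auto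
    then show False using y matroid_finite[OF M Y(1)] by simp
  qed
  then have "insert w K \<in> \<I>" using y(2) Y(2) by (auto intro: matroid_subset[OF M])
  \<comment> \<open>Removing from \<open>B\<close> only elements outside the circuit would leave
    room for \<open>w\<close>, so one of them would be exchangeable for \<open>w\<close>.\<close>
  moreover have "insert w K = insert w B - (B - K)" using w by (auto simp: K_def)
  ultimately obtain a where "a \<in> B - K" "insert w B - {a} \<in> \<I>"
    using basis_exchange[OF M B, of w "B - K"] w by auto
  then show False by (simp add: K_def)
qed

lemma basis_swap:
  assumes M: "matroid V \<I>" and B: "basis \<I> B" and "w \<notin> B" "u \<in> B" "insert w B - {u} \<in> \<I>"
  shows "basis \<I> (insert w B - {u})"
  using assms matroid_finite[OF M basis_indep[OF B]]
  by (intro basis_if_card[OF M B]) (auto simp: card_Diff_singleton_if)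

section \<open>Multilinear extensions\<close>

text \<open>Condition the random set on whether it contains \<open>v\<close>. In particular the
  extension is affine in each coordinate.\<close>

lemma multilinear_extension_insert:
  assumes "finite V" "v \<notin> V"
  shows "multilinear_extension (insert v V) f x =
    x v * multilinear_extension V (\<lambda>S. f (insert v S)) x + (1 - x v) * multilinear_extension V f x"
proof -
  have "multilinear_extension (insert v V) f x =
      (\<Sum>S\<in>Pow V. f S * (\<Prod>v\<in>S. x v) * (\<Prod>v\<in>insert v V - S. 1 - x v)) +
      (\<Sum>S\<in>insert v ` Pow V. f S * (\<Prod>v\<in>S. x v) * (\<Prod>v\<in>insert v V - S. 1 - x v))"
    unfolding multilinear_extension_def Pow_insert using assms
    by (intro sum.union_disjoint) auto
  also have "(\<Sum>S\<in>insert v ` Pow V. f S * (\<Prod>v\<in>S. x v) * (\<Prod>v\<in>insert v V - S. 1 - x v)) =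
      (\<Sum>S\<in>Pow V. f (insert v S) * (\<Prod>v\<in>insert v S. x v) * (\<Prod>v\<in>insert v V - insert v S. 1 - x v))"
    using assms by (subst sum.reindex) (auto simp: inj_on_def)
  also have "\<dots> = x v * multilinear_extension V (\<lambda>S. f (insert v S)) x"
    unfolding multilinear_extension_def sum_distrib_left
  proof (intro sum.cong refl)
    fix S assume S: "S \<in> Pow V"
    then have "finite S" "v \<notin> S" using assms by (auto intro: finite_subset)
    moreover have "insert v V - insert v S = V - S" using assms by auto
    ultimately show "f (insert v S) * (\<Prod>v\<in>insert v S. x v) * (\<Prod>v\<in>insert v V - insert v S. 1 - x v) =
      x v * (f (insert v S) * (\<Prod>v\<in>S. x v) * (\<Prod>v\<in>V - S. 1 - x v))"
      by simp
  qed
  also have "(\<Sum>S\<in>Pow V. f S * (\<Prod>v\<in>S. x v) * (\<Prod>v\<in>insert v V - S. 1 - x v)) =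
      (1 - x v) * multilinear_extension V f x"
    unfolding multilinear_extension_def sum_distrib_left
  proof (intro sum.cong refl)
    fix S assume S: "S \<in> Pow V"
    then have "insert v V - S = insert v (V - S)" using assms by auto
    then show "f S * (\<Prod>v\<in>S. x v) * (\<Prod>v\<in>insert v V - S. 1 - x v) =
      (1 - x v) * (f S * (\<Prod>v\<in>S. x v) * (\<Prod>v\<in>V - S. 1 - x v))"
      using assms by simp
  qed
  finally show ?thesis by simp
qed

lemma multilinear_extension_cong:
  assumes "\<And>v. v \<in> V \<Longrightarrow> x v = y v"
  shows "multilinear_extension V f x = multilinear_extension V f y"
proof -
  have "(\<Prod>v\<in>S. x v) = (\<Prod>v\<in>S. y v)" "(\<Prod>v\<in>V - S. 1 - x v) = (\<Prod>v\<in>V - S. 1 - y v)"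
    if "S \<in> Pow V" for S
    using that assms by (auto intro!: prod.cong)
  then show ?thesis by (simp add: multilinear_extension_def)
qed

lemma multilinear_extension_mono:
  assumes "\<And>S. S \<subseteq> V \<Longrightarrow> f S \<le> g S" and "\<And>v. v \<in> V \<Longrightarrow> 0 \<le> x v \<and> x v \<le> 1"
  shows "multilinear_extension V f x \<le> multilinear_extension V g x"
  unfolding multilinear_extension_def using assms
  by (intro sum_mono mult_right_mono prod_nonneg) auto

lemma multilinear_extension_nonneg:
  assumes "\<And>S. S \<subseteq> V \<Longrightarrow> 0 \<le> f S" and "\<And>v. v \<in> V \<Longrightarrow> 0 \<le> x v \<and> x v \<le> 1"
  shows "0 \<le> multilinear_extension V f x"
  unfolding multilinear_extension_def using assms
  by (intro sum_nonneg mult_nonneg_nonneg prod_nonneg) auto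

lemma multilinear_extension_add:
  "multilinear_extension V (\<lambda>S. f S + g S) x = multilinear_extension V f x + multilinear_extension V g x"
  by (simp add: multilinear_extension_def sum.distrib distrib_right)

lemma multilinear_extension_diff:
  "multilinear_extension V (\<lambda>S. f S - g S) x = multilinear_extension V f x - multilinear_extension V g x"
  by (simp add: multilinear_extension_def sum_subtractf left_diff_distrib)

lemma multilinear_extension_indicator:
  assumes "finite V" "B \<subseteq> V"
  shows "multilinear_extension V f (indicator B) = f B"
proof -
  have "(\<Prod>v\<in>S. indicator B v) * (\<Prod>v\<in>V - S. 1 - indicator B v) = (if S = B then 1 else 0 :: real)"
    if "S \<in> Pow V" for S
  proof (cases "S = B")
    case False
    then obtain v where "v \<in> S - B \<or> v \<in> B - S" by blast
    then show ?thesis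
    proof
      assume "v \<in> S - B"
      then have "(\<Prod>v\<in>S. indicator B v :: real) = 0"
        using that assms by (intro prod_zero) (auto intro: finite_subset intro!: bexI[of _ v])
      then show ?thesis using False by simp
    next
      assume "v \<in> B - S"
      then have "(\<Prod>v\<in>V - S. 1 - indicator B v :: real) = 0"
        using that assms by (intro prod_zero) (auto intro!: bexI[of _ v])
      then show ?thesis using False by simp
    qed
  qed simp
  then have "multilinear_extension V f (indicator B) = (\<Sum>S\<in>Pow V. if S = B then f S else 0)"
    unfolding multilinear_extension_def mult.assoc by (intro sum.cong) auto
  also have "\<dots> = f B" using assms by (simp add: sum.delta)
  finally show ?thesis .
qed

text \<open>The partial derivative in coordinate \<open>v\<close>: the extension is affine in
  \<open>x v\<close>, so its slope is the difference of the values at 1 and 0.\<close>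

definition multilinear_deriv :: "'a set \<Rightarrow> ('a set \<Rightarrow> real) \<Rightarrow> ('a \<Rightarrow> real) \<Rightarrow> 'a \<Rightarrow> real" where
  "multilinear_deriv V f x v = multilinear_extension (V - {v}) (\<lambda>S. f (insert v S) - f S) x"

text \<open>Along the line raising \<open>w\<close> and lowering \<open>u\<close> at equal rate the
  extension is quadratic. Its leading coefficient is nonnegative by submodularity, so it lies above
  its tangent at \<open>x\<close>.\<close>

lemma multilinear_extension_tangent:
  assumes V: "finite V" and sub: "submodular_on V f" and wu: "w \<in> V" "u \<in> V" "w \<noteq> u"
    and x: "\<And>v. v \<in> V \<Longrightarrow> 0 \<le> x v \<and> x v \<le> 1"
    and y: "y w = x w + c" "y u = x u - c" "\<And>v. v \<in> V - {w, u} \<Longrightarrow> y v = x v"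
  shows "multilinear_extension V f x + c * (multilinear_deriv V f x w - multilinear_deriv V f x u)
    \<le> multilinear_extension V f y"
proof -
  define W where "W = V - {w, u}"
  have W: "V = insert w (insert u W)" "finite W" "w \<notin> insert u W" "u \<notin> W"
    using V wu by (auto simp: W_def)
  have Vw: "V - {w} = insert u W" and Vu: "V - {u} = insert w W" "w \<notin> W" using W wu by auto
  define F where "F g = multilinear_extension W g x" for g
  have Fy: "multilinear_extension W g y = F g" for g
    unfolding F_def by (rule multilinear_extension_cong) (auto simp: W_def y)
  \<comment> \<open>The two digits record whether \<open>w\<close> and \<open>u\<close> are forced
    into the random set; the remaining elements are drawn according to \<open>x\<close>.\<close>
  define a00 where "a00 = F f"
  define a10 where "a10 = F (\<lambda>S. f (insert w S))"
  define a01 where "a01 = F (\<lambda>S. f (insert u S))"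
  define a11 where "a11 = F (\<lambda>S. f (insert w (insert u S)))"
  have c: "insert u (insert w S) = insert w (insert u S)" for S by auto
  have "F (\<lambda>S. f (insert w (insert u S)) + f S) \<le> F (\<lambda>S. f (insert w S) + f (insert u S))"
    unfolding F_def
  proof (rule multilinear_extension_mono)
    fix S assume S: "S \<subseteq> W"
    have "insert w S \<union> insert u S = insert w (insert u S)" "insert w S \<inter> insert u S = S"
      using S wu W by auto
    moreover have "insert w S \<subseteq> V" "insert u S \<subseteq> V" using S W by auto
    ultimately show "f (insert w (insert u S)) + f S \<le> f (insert w S) + f (insert u S)"
      using sub unfolding submodular_on_def by metis
  qed (use x W in auto)
  then have "a11 + a00 \<le> a10 + a01"
    by (simp add: F_def multilinear_extension_add a00_def a10_def a01_def a11_def)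
  then have quad: "c * c * (a11 + a00 - a10 - a01) \<le> 0"
    by (simp add: mult_nonneg_nonpos)
  have expand: "multilinear_extension V f z =
      z w * (z u * a11 + (1 - z u) * a10) + (1 - z w) * (z u * a01 + (1 - z u) * a00)"
    if "z = x \<or> z = y" for z
    using that unfolding W(1) a00_def a10_def a01_def a11_def
    by (auto simp: multilinear_extension_insert W Vu(2) wu(3) F_def Fy c)
  have dw: "multilinear_deriv V f x w = x u * (a11 - a01) + (1 - x u) * (a10 - a00)"
    unfolding multilinear_deriv_def Vw a00_def a10_def a01_def a11_def
    by (simp add: multilinear_extension_insert multilinear_extension_diff W wu(3) F_def) (simp add: algebra_simps)
  have du: "multilinear_deriv V f x u = x w * (a11 - a10) + (1 - x w) * (a01 - a00)"
    unfolding multilinear_deriv_def Vu a00_def a10_def a01_def a11_def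
    by (simp add: multilinear_extension_insert multilinear_extension_diff W Vu(2) F_def c) (simp add: algebra_simps)
  \<comment> \<open>The gap to the tangent is exactly the second-order term, since the two
    coordinates enter bilinearly.\<close>
  have "multilinear_extension V f y - (multilinear_extension V f x +
      c * (multilinear_deriv V f x w - multilinear_deriv V f x u)) = - (c * c * (a11 + a00 - a10 - a01))"
    unfolding dw du expand[OF disjI1[OF refl]] expand[OF disjI2[OF refl]] y(1,2) by algebra
  with quad show ?thesis by linarith
qed

section \<open>Oracle algorithms\<close>

primrec bind_alg :: "('a, 'r) oracle_alg \<Rightarrow> ('r \<Rightarrow> ('a, 's) oracle_alg) \<Rightarrow> ('a, 's) oracle_alg" where
  "bind_alg (Return a) f = f a"
| "bind_alg (Query S k) f = Query S (\<lambda>b. bind_alg (k b) f)"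
| "bind_alg (Sample p k) f = Sample p (\<lambda>n. bind_alg (k n) f)"

text \<open>\<open>Sample\<close> draws natural numbers only. The support of a pmf is countable, so
  an enumeration of it encodes any distribution.\<close>

definition sample :: "'r pmf \<Rightarrow> ('a, 'r) oracle_alg" where
  "sample p = Sample (map_pmf (to_nat_on (set_pmf p)) p) (\<lambda>n. Return (from_nat_into (set_pmf p) n))"

lemma run_bind_alg:
  "run orc (bind_alg m f) =
    bind_pmf (run orc m) (\<lambda>(a, q). map_pmf (\<lambda>(b, q'). (b, q + q')) (run orc (f a)))"
  by (induction m)
    (simp_all add: bind_return_pmf map_bind_pmf bind_map_pmf bind_assoc_pmf case_prod_unfold
      map_pmf_comp)

lemma run_sample: "run orc (sample p) = map_pmf (\<lambda>a. (a, 0)) p"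
  unfolding sample_def run.simps map_pmf_def bind_assoc_pmf bind_return_pmf
  by (intro bind_pmf_cong) auto

text \<open>A worst-case judgement over all outcomes of positive probability, so query bounds hold
  for every run and not merely on average.\<close>

definition yields :: "('a set \<Rightarrow> bool) \<Rightarrow> ('a, 'r) oracle_alg \<Rightarrow> nat \<Rightarrow> ('r \<Rightarrow> bool) \<Rightarrow> bool" where
  "yields orc m n P \<longleftrightarrow> (\<forall>(a, q)\<in>set_pmf (run orc m). P a \<and> q \<le> n)"

lemma yields_Return: "P a \<Longrightarrow> yields orc (Return a) n P"
  by (simp add: yields_def)

lemma yields_Query: "yields orc (k (orc S)) n P \<Longrightarrow> yields orc (Query S k) (Suc n) P"
  by (auto simp: yields_def)

lemma yields_sample: "(\<And>a. a \<in> set_pmf p \<Longrightarrow> P a) \<Longrightarrow> yields orc (sample p) 0 P"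
  by (auto simp: yields_def run_sample)

lemma yields_bind:
  assumes "yields orc m n P" and "\<And>a. P a \<Longrightarrow> yields orc (f a) n' Q"
  shows "yields orc (bind_alg m f) (n + n') Q"
  using assms unfolding yields_def run_bind_alg by (fastforce intro: add_mono)

lemma yields_mono:
  assumes "yields orc m n P" and "n \<le> n'" and "\<And>a. P a \<Longrightarrow> Q a"
  shows "yields orc m n' Q"
  using assms unfolding yields_def by fastforce

text \<open>Values in \<open>ennreal\<close> keep integrability out of the recursion over the
  algorithm; it is settled once, when the result becomes a real expectation.\<close>

definition expect :: "('a set \<Rightarrow> bool) \<Rightarrow> ('a, 'r) oracle_alg \<Rightarrow> ('r \<Rightarrow> ennreal) \<Rightarrow> ennreal" where
  "expect orc m h = (\<integral>\<^sup>+ z. h (fst z) \<partial>measure_pmf (run orc m))"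

lemma expect_Return [simp]: "expect orc (Return a) h = h a"
  by (simp add: expect_def nn_integral_return)

lemma expect_sample: "expect orc (sample p) h = (\<integral>\<^sup>+ a. h a \<partial>measure_pmf p)"
  by (simp add: expect_def run_sample)

lemma expect_bind: "expect orc (bind_alg m f) h = expect orc m (\<lambda>a. expect orc (f a) h)"
  by (simp add: expect_def run_bind_alg case_prod_unfold)

text \<open>Together with \<open>expect_bind\<close> this composes multiplicative losses: a factor
  \<open>c\<close> lost in the continuation can be pulled out of the expectation.\<close>

lemma expect_mono:
  assumes "yields orc m n P" and "\<And>a. P a \<Longrightarrow> ennreal c * h a \<le> h' a"
  shows "ennreal c * expect orc m h \<le> expect orc m h'"
proof -
  have "ennreal c * expect orc m h = (\<integral>\<^sup>+ z. ennreal c * h (fst z) \<partial>measure_pmf (run orc m))"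
    unfolding expect_def by (subst nn_integral_cmult) auto
  also have "\<dots> \<le> expect orc m h'"
    unfolding expect_def using assms
    by (intro nn_integral_mono_AE) (auto simp: AE_measure_pmf_iff yields_def)
  finally show ?thesis .
qed

lemma expect_ge:
  assumes "yields orc m n P" and "\<And>a. P a \<Longrightarrow> c \<le> h a"
  shows "c \<le> expect orc m h"
  using expect_mono[OF assms(1), of 1 "\<lambda>_. c" h] assms(2)
  by (simp add: expect_def)

section \<open>Short cycles of exchange arcs\<close>

definition list_of :: "'a set \<Rightarrow> 'a list" where
  "list_of A = (SOME l. set l = A \<and> distinct l)"

lemma list_of:
  assumes "finite A"
  shows "set (list_of A) = A" "length (list_of A) = card A"
proof -
  have "set (list_of A) = A \<and> distinct (list_of A)"
    unfolding list_of_def by (rule someI_ex) (rule finite_distinct_list[OF assms])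
  then show "set (list_of A) = A" "length (list_of A) = card A"
    by (auto dest: distinct_card)
qed

text \<open>Binary search under the invariant that \<open>as\<close> has at most
  \<open>2 ^ k\<close> entries, some \<open>a\<close> among them with \<open>X - {a}\<close>
  independent. Removing the whole first half tests whether such an \<open>a\<close> lies
  there.\<close>

primrec locate :: "nat \<Rightarrow> 'a set \<Rightarrow> 'a list \<Rightarrow> ('a, 'a) oracle_alg" where
  "locate 0 X as = Return (hd as)"
| "locate (Suc k) X as = Query (X - set (take (2 ^ k) as))
    (\<lambda>b. locate k X (if b then take (2 ^ k) as else drop (2 ^ k) as))"

definition search :: "nat \<Rightarrow> 'a set \<Rightarrow> 'a \<Rightarrow> 'a set \<Rightarrow> ('a, 'a option) oracle_alg" where
  "search k B w A = Query (insert w B - A)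
    (\<lambda>b. if b then bind_alg (locate k (insert w B) (list_of A)) (\<lambda>u. Return (Some u)) else Return None)"

abbreviation (input) indep :: "'a set set \<Rightarrow> 'a set \<Rightarrow> bool" where
  "indep \<I> \<equiv> \<lambda>S. S \<in> \<I>"

definition exchange_arcs :: "'a set set \<Rightarrow> 'a set \<Rightarrow> 'a set \<Rightarrow> ('a \<times> 'a) set" where
  "exchange_arcs \<I> B B' = {(w, u). w \<in> B' - B \<and> u \<in> B - B' \<and> insert w B - {u} \<in> \<I>}"

definition exchange_digraph :: "'a set set \<Rightarrow> 'a set \<Rightarrow> 'a set \<Rightarrow> ('a \<times> 'a) set" where
  "exchange_digraph \<I> B B' = exchange_arcs \<I> B B' \<union> exchange_arcs \<I> B' B"

lemma exchange_digraph_commute: "exchange_digraph \<I> B B' = exchange_digraph \<I> B' B"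
  by (auto simp: exchange_digraph_def)

text \<open>A finite set of arcs is balanced iff it is a vertex-disjoint union of directed cycles.\<close>

definition balanced :: "('a \<times> 'a) set \<Rightarrow> bool" where
  "balanced es \<longleftrightarrow> inj_on fst es \<and> inj_on snd es \<and> fst ` es = snd ` es"

lemma balanced_empty: "balanced {}"
  by (simp add: balanced_def)

lemma balanced_two_cycle: "balanced {(w, u), (u, w)}"
  by (auto simp: balanced_def)

text \<open>Sources and targets run through the same vertices, each once, so the sum
  telescopes.\<close>

lemma balanced_sum_eq_0:
  fixes g :: "'a \<Rightarrow> real"
  assumes "balanced es"
  shows "(\<Sum>(w, u)\<in>es. g w - g u) = 0"
proof -
  have "(\<Sum>e\<in>es. g (fst e)) = (\<Sum>e\<in>es. g (snd e))"
    using assms unfolding balanced_def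
    by (metis (no_types, lifting) comp_def sum.cong sum.reindex)
  then show ?thesis by (simp add: case_prod_unfold sum_subtractf)
qed

text \<open>Fix one successor \<open>g w\<close> for each source. A smallest nonempty set closed
  under \<open>g\<close> is mapped onto itself, so \<open>g\<close> permutes it and its arcs form
  directed cycles.\<close>

lemma balanced_subset_exists:
  assumes fin: "finite E" and ne: "E \<noteq> {}" and out: "snd ` E \<subseteq> fst ` E"
  shows "\<exists>es\<subseteq>E. es \<noteq> {} \<and> balanced es"
proof -
  have "\<forall>w\<in>fst ` E. \<exists>u. (w, u) \<in> E" by auto
  then obtain g where g: "\<And>w. w \<in> fst ` E \<Longrightarrow> (w, g w) \<in> E" by metis
  define P where "P X \<longleftrightarrow> X \<subseteq> fst ` E \<and> X \<noteq> {} \<and> g ` X \<subseteq> X" for X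
  have "P (fst ` E)" using g out ne by (force simp: P_def)
  then obtain X where X: "P X" "\<And>Y. P Y \<Longrightarrow> card X \<le> card Y"
    using ex_has_least_nat[of P _ card] by blast
  have finX: "finite X" using X(1) fin by (auto simp: P_def intro: finite_subset)
  have "P (g ` X)" using X(1) by (auto simp: P_def)
  then have "card X \<le> card (g ` X)" by (rule X(2))
  then have img: "g ` X = X" using X(1) finX by (intro card_seteq) (auto simp: P_def)
  then have "inj_on g X" using finX by (simp add: eq_card_imp_inj_on)
  with img have "balanced ((\<lambda>w. (w, g w)) ` X)"
    by (auto simp: balanced_def inj_on_def image_image)
  moreover have "(\<lambda>w. (w, g w)) ` X \<subseteq> E" "(\<lambda>w. (w, g w)) ` X \<noteq> {}"
    using X(1) unfolding P_def by (auto intro!: g)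
  ultimately show ?thesis by blast
qed

text \<open>The counter limits how many successors of \<open>w\<close> are tried. Each one found is
  tested for the reverse arc and then removed from \<open>A\<close>, so that the next search returns
  a new one.\<close>

primrec probe :: "nat \<Rightarrow> 'a set \<Rightarrow> 'a set \<Rightarrow> 'a \<Rightarrow> nat \<Rightarrow> 'a set \<Rightarrow> ('a, ('a \<times> 'a) set) oracle_alg" where
  "probe k B B' w 0 A = Return {}"
| "probe k B B' w (Suc n) A = bind_alg (search k B w A) (\<lambda>r. case r of
      None \<Rightarrow> Return {}
    | Some u \<Rightarrow> Query (insert u B' - {w})
        (\<lambda>b. if b then Return {(w, u), (u, w)} else probe k B B' w n (A - {u})))"

definition lacking :: "'a set \<Rightarrow> 'a set \<Rightarrow> 'a \<Rightarrow> 'a set" where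
  "lacking B B' w = (if w \<in> B then B' else B)"

definition holding :: "'a set \<Rightarrow> 'a set \<Rightarrow> 'a \<Rightarrow> 'a set" where
  "holding B B' w = (if w \<in> B then B else B')"

text \<open>\<open>E\<close> collects one arc inside \<open>R\<close> out of each vertex handled so
  far. At the end the cycles are chosen among known arcs, which takes no query; the first vertex
  without a successor in \<open>R\<close> is passed to \<open>probe\<close>.\<close>

primrec scan :: "nat \<Rightarrow> nat \<Rightarrow> 'a set \<Rightarrow> 'a set \<Rightarrow> 'a set \<Rightarrow> ('a \<times> 'a) set \<Rightarrow> 'a list
    \<Rightarrow> ('a, ('a \<times> 'a) set) oracle_alg" where
  "scan K k B B' R E [] = Return (SOME es. es \<subseteq> E \<and> es \<noteq> {} \<and> balanced es)"
| "scan K k B B' R E (w # ws) =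
    bind_alg (search k (lacking B B' w) w (R \<inter> (lacking B B' w - holding B B' w))) (\<lambda>r. case r of
      None \<Rightarrow> probe k (lacking B B' w) (holding B B' w) w K (lacking B B' w - holding B B' w)
    | Some u \<Rightarrow> scan K k B B' R (insert (w, u) E) ws)"

section \<open>Correctness and cost of the cycle search\<close>

lemma locate_yields:
  assumes iff: "\<And>A. A \<subseteq> S \<Longrightarrow> X - A \<in> \<I> \<longleftrightarrow> (\<exists>a\<in>A. X - {a} \<in> \<I>)"
    and "set as \<subseteq> S" "length as \<le> 2 ^ k" "\<exists>a\<in>set as. X - {a} \<in> \<I>"
  shows "yields (indep \<I>) (locate k X as) k (\<lambda>a. a \<in> set as \<and> X - {a} \<in> \<I>)"
  using assms(2-)
proof (induction k arbitrary: as)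
  case 0
  then obtain a where "as = [a]" by (cases as) auto
  with 0 show ?case by (auto intro: yields_Return)
next
  case (Suc k)
  let ?L = "take (2 ^ k) as" and ?R = "drop (2 ^ k) as"
  have as: "set as = set ?L \<union> set ?R" by (metis append_take_drop_id set_append)
  have L: "X - set ?L \<in> \<I> \<longleftrightarrow> (\<exists>a\<in>set ?L. X - {a} \<in> \<I>)"
    using Suc.prems(1) as by (intro iff) auto
  let ?C = "if X - set ?L \<in> \<I> then ?L else ?R"
  have *: "yields (indep \<I>) (locate k X ?C) k (\<lambda>a. a \<in> set ?C \<and> X - {a} \<in> \<I>)"
    using Suc.prems as L by (intro Suc.IH) (auto simp: le_diff_conv)
  show ?case unfolding locate.simps
    by (intro yields_Query yields_mono[OF *]) (auto simp: as split: if_splits)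
qed

context
  fixes V :: "'a set" and \<I> :: "'a set set"
  assumes M: "matroid V \<I>"
begin

lemma search_yields:
  assumes B: "basis \<I> B" and w: "w \<notin> B" and A: "A \<subseteq> B" "card A \<le> 2 ^ k"
  shows "yields (indep \<I>) (search k B w A) (Suc k) (\<lambda>r. case r of
      None \<Rightarrow> \<forall>u\<in>A. insert w B - {u} \<notin> \<I>
    | Some u \<Rightarrow> u \<in> A \<and> insert w B - {u} \<in> \<I>)" (is "yields _ _ _ ?P")
proof -
  have "finite A" using A matroid_finite[OF M basis_indep[OF B]] finite_subset by blast
  note list_of = list_of[OF this]
  note iff = basis_exchange_iff[OF M B w]
  show ?thesis
  proof (cases "insert w B - A \<in> \<I>")
    case True
    have "yields (indep \<I>) (locate k (insert w B) (list_of A)) k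
        (\<lambda>a. a \<in> set (list_of A) \<and> insert w B - {a} \<in> \<I>)"
      using True iff A by (intro locate_yields[where S = B]) (auto simp: list_of)
    then have "yields (indep \<I>) (bind_alg (locate k (insert w B) (list_of A)) (\<lambda>u. Return (Some u))) (k + 0) ?P"
      by (rule yields_bind) (auto simp: list_of intro: yields_Return)
    then show ?thesis unfolding search_def using True by (intro yields_Query) simp
  next
    case False
    then have "\<forall>u\<in>A. insert w B - {u} \<notin> \<I>" using iff A by auto
    then show ?thesis unfolding search_def using False by (intro yields_Query) (simp add: yields_Return)
  qed
qed

lemma exchange_arcs_basis:
  assumes "basis \<I> B" "(w, u) \<in> exchange_arcs \<I> B B'"
  shows "basis \<I> (insert w B - {u})"
  using assms by (auto simp: exchange_arcs_def intro: basis_swap[OF M])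

text \<open>A round costs \<open>k + 1\<close> queries for the search and one for the reverse arc.
  An unsuccessful round uses up one successor in \<open>A\<close>, so \<open>n\<close> rounds
  suffice if there are at most \<open>n\<close> and one of them closes a 2-cycle.\<close>

lemma probe_yields:
  assumes B: "basis \<I> B" and B': "basis \<I> B'" and w: "w \<in> B' - B"
    and k: "card (B - B') \<le> 2 ^ k" and "A \<subseteq> B - B'"
  shows "yields (indep \<I>) (probe k B B' w n A) (n * (k + 2)) (\<lambda>es.
    es \<subseteq> exchange_digraph \<I> B B' \<and> balanced es \<and>
    ((\<exists>u\<in>A. (w, u) \<in> exchange_arcs \<I> B B' \<and> (u, w) \<in> exchange_arcs \<I> B' B) \<and>
      card {u\<in>A. (w, u) \<in> exchange_arcs \<I> B B'} \<le> n \<longrightarrow> es \<noteq> {}))"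
  using assms(5-)
proof (induction n arbitrary: A)
  case 0
  \<comment> \<open>With no rounds left the premise is contradictory: a finite set of cardinality 0
    would contain a successor.\<close>
  have "finite A" using 0 matroid_finite[OF M basis_indep[OF B]] by (meson Diff_subset finite_subset)
  then show ?case by (auto intro!: yields_Return simp: balanced_empty)
next
  case (Suc n)
  have fin: "finite (B - B')" using matroid_finite[OF M basis_indep[OF B]] by simp
  then have finA: "finite A" "card A \<le> 2 ^ k"
    using Suc.prems k by (auto intro: finite_subset order_trans[OF card_mono])
  let ?out = "\<lambda>A. {u\<in>A. (w, u) \<in> exchange_arcs \<I> B B'}"
  have arc: "(w, u) \<in> exchange_arcs \<I> B B' \<longleftrightarrow> insert w B - {u} \<in> \<I>" if "u \<in> A" for u
    using that Suc.prems w by (auto simp: exchange_arcs_def)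
  have arc': "(u, w) \<in> exchange_arcs \<I> B' B \<longleftrightarrow> insert u B' - {w} \<in> \<I>" if "u \<in> A" for u
    using that Suc.prems w by (auto simp: exchange_arcs_def)
  have bound: "Suc n * (k + 2) = Suc k + Suc (n * (k + 2))" by simp
  show ?case unfolding probe.simps bound
  proof (rule yields_bind)
    show "yields (indep \<I>) (search k B w A) (Suc k) (\<lambda>r. case r of
      None \<Rightarrow> \<forall>u\<in>A. insert w B - {u} \<notin> \<I>
    | Some u \<Rightarrow> u \<in> A \<and> insert w B - {u} \<in> \<I>)"
      using B w Suc.prems finA by (intro search_yields) auto
  next
    fix r assume r: "case r of None \<Rightarrow> \<forall>u\<in>A. insert w B - {u} \<notin> \<I>
      | Some u \<Rightarrow> u \<in> A \<and> insert w B - {u} \<in> \<I>"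
    let ?P = "\<lambda>es. es \<subseteq> exchange_digraph \<I> B B' \<and> balanced es \<and>
      ((\<exists>u\<in>A. (w, u) \<in> exchange_arcs \<I> B B' \<and> (u, w) \<in> exchange_arcs \<I> B' B) \<and>
       card (?out A) \<le> Suc n \<longrightarrow> es \<noteq> {})"
    show "yields (indep \<I>) (case r of None \<Rightarrow> Return {}
        | Some u \<Rightarrow> Query (insert u B' - {w})
          (\<lambda>b. if b then Return {(w, u), (u, w)} else probe k B B' w n (A - {u})))
      (Suc (n * (k + 2))) ?P"
    proof (cases r)
      case None
      then have "?P {}" using r arc by (auto simp: balanced_empty)
      then show ?thesis by (simp add: None yields_Return)
    next
      case (Some u)
      then have u: "u \<in> A" "(w, u) \<in> exchange_arcs \<I> B B'" using r arc by auto
      show ?thesis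
      proof (cases "insert u B' - {w} \<in> \<I>")
        case True
        then have "?P {(w, u), (u, w)}"
          using u arc' by (auto simp: balanced_two_cycle exchange_digraph_def)
        then show ?thesis using True by (simp add: Some yields_Query yields_Return)
      next
        case False
        have "?out A = insert u (?out (A - {u}))" using u by auto
        then have card: "card (?out A) = Suc (card (?out (A - {u})))" using finA by simp
        have "yields (indep \<I>) (probe k B B' w n (A - {u})) (n * (k + 2)) ?P"
        proof (rule yields_mono[OF Suc.IH])
          fix es
          assume *: "es \<subseteq> exchange_digraph \<I> B B' \<and> balanced es \<and>
            ((\<exists>u\<in>A - {u}. (w, u) \<in> exchange_arcs \<I> B B' \<and> (u, w) \<in> exchange_arcs \<I> B' B) \<and>
              card (?out (A - {u})) \<le> n \<longrightarrow> es \<noteq> {})"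
          have "\<exists>v\<in>A - {u}. (w, v) \<in> exchange_arcs \<I> B B' \<and> (v, w) \<in> exchange_arcs \<I> B' B"
            if "\<exists>v\<in>A. (w, v) \<in> exchange_arcs \<I> B B' \<and> (v, w) \<in> exchange_arcs \<I> B' B"
            using that False arc'[OF u(1)] by auto
          with * card show "?P es" by auto
        qed (use Suc.prems in auto)
        then show ?thesis using False by (simp add: Some yields_Query)
      qed
    qed
  qed
qed

text \<open>If \<open>R\<close> meets the out-neighbourhood of every vertex of out-degree more than \<open>K\<close>, then either every
  vertex of \<open>R\<close> has a successor in \<open>R\<close>, so there is a cycle inside \<open>R\<close>, or some vertex has few
  successors, one of which closes a 2-cycle by symmetric exchange.\<close>

lemma scan_yields:
  assumes B: "basis \<I> B" and B': "basis \<I> B'" and r: "card B \<le> 2 ^ k"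
    and R: "R \<subseteq> (B - B') \<union> (B' - B)" "finite R" "R \<noteq> {}"
    and "E \<subseteq> exchange_digraph \<I> B B'" "fst ` E \<union> set ws = R" "snd ` E \<subseteq> R" "finite E"
  shows "yields (indep \<I>) (scan K k B B' R E ws) (length ws * Suc k + K * (k + 2)) (\<lambda>es.
    es \<subseteq> exchange_digraph \<I> B B' \<and> balanced es \<and>
    ((\<forall>w\<in>(B - B') \<union> (B' - B). K < card (exchange_digraph \<I> B B' `` {w}) \<longrightarrow>
       exchange_digraph \<I> B B' `` {w} \<inter> R \<noteq> {}) \<longrightarrow> es \<noteq> {}))"
    (is "yields _ _ _ ?P")
  using assms(7-)
proof (induction ws arbitrary: E)
  case Nil
  let ?es = "SOME es. es \<subseteq> E \<and> es \<noteq> {} \<and> balanced es"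
  \<comment> \<open>Every vertex of \<open>R\<close> is now the source of an arc of
    \<open>E\<close>, and all targets lie in \<open>R\<close>.\<close>
  have "\<exists>es\<subseteq>E. es \<noteq> {} \<and> balanced es"
    using Nil R by (intro balanced_subset_exists) auto
  then have "?es \<subseteq> E \<and> ?es \<noteq> {} \<and> balanced ?es" by (rule someI_ex)
  then show ?case using Nil.prems by (auto intro!: yields_Return)
next
  case (Cons w ws)
  \<comment> \<open>Arcs out of \<open>w\<close> are exchanges in the basis lacking
    \<open>w\<close>. Calling it \<open>L\<close> treats both sides of the digraph at once.\<close>
  define L where "L = lacking B B' w"
  define H where "H = holding B B' w"
  have LH: "basis \<I> L" "basis \<I> H" "w \<in> H - L" "exchange_digraph \<I> B B' = exchange_digraph \<I> L H"
    using B B' Cons.prems(2) R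
    by (auto simp: L_def H_def lacking_def holding_def exchange_digraph_commute split: if_splits)
  have "finite L" using LH(1) matroid_finite[OF M] basis_indep by blast
  have cL: "card L \<le> 2 ^ k" using card_basis_eq[OF M LH(1) B] r by simp
  have cLH: "card (L - H) \<le> 2 ^ k" "card (R \<inter> (L - H)) \<le> 2 ^ k"
    using \<open>finite L\<close> cL by (auto intro: order_trans[OF card_mono])
  \<comment> \<open>The digraph is bipartite, so all arcs out of \<open>w\<close> come from the same
    one of its two halves.\<close>
  have nbrs: "exchange_digraph \<I> B B' `` {w} = {u\<in>L - H. (w, u) \<in> exchange_arcs \<I> L H}"
    unfolding LH(4) unfolding exchange_digraph_def using LH(3) by (auto simp: exchange_arcs_def)
  have arc: "(w, u) \<in> exchange_arcs \<I> L H \<longleftrightarrow> insert w L - {u} \<in> \<I>" if "u \<in> L - H" for u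
    using that LH(3) by (auto simp: exchange_arcs_def)
  have bound: "length (w # ws) * Suc k + K * (k + 2) = Suc k + (length ws * Suc k + K * (k + 2))"
    by simp
  show ?case unfolding scan.simps bound L_def[symmetric] H_def[symmetric]
  proof (rule yields_bind)
    show "yields (indep \<I>) (search k L w (R \<inter> (L - H))) (Suc k) (\<lambda>r. case r of
      None \<Rightarrow> \<forall>u\<in>R \<inter> (L - H). insert w L - {u} \<notin> \<I>
    | Some u \<Rightarrow> u \<in> R \<inter> (L - H) \<and> insert w L - {u} \<in> \<I>)"
      using LH cLH by (intro search_yields) auto
  next
    fix r assume r: "case r of None \<Rightarrow> \<forall>u\<in>R \<inter> (L - H). insert w L - {u} \<notin> \<I>
      | Some u \<Rightarrow> u \<in> R \<inter> (L - H) \<and> insert w L - {u} \<in> \<I>"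
    show "yields (indep \<I>) (case r of None \<Rightarrow> probe k L H w K (L - H)
        | Some u \<Rightarrow> scan K k B B' R (insert (w, u) E) ws) (length ws * Suc k + K * (k + 2)) ?P"
    proof (cases r)
      case None
      obtain u where u: "u \<in> L - H" "insert w L - {u} \<in> \<I>" "insert u H - {w} \<in> \<I>"
        using basis_symmetric_exchange[OF M LH(1-3)] by auto
      then have u': "\<exists>u\<in>L - H. (w, u) \<in> exchange_arcs \<I> L H \<and> (u, w) \<in> exchange_arcs \<I> H L"
        using LH(3) by (intro bexI[of _ u]) (auto simp: exchange_arcs_def)
      have "exchange_digraph \<I> B B' `` {w} \<inter> R = {}" using r None arc by (auto simp: nbrs)
      moreover have "w \<in> (B - B') \<union> (B' - B)" using Cons.prems(2) R by auto
      ultimately have small: "card (exchange_digraph \<I> B B' `` {w}) \<le> K"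
        if "\<forall>w\<in>(B - B') \<union> (B' - B). K < card (exchange_digraph \<I> B B' `` {w}) \<longrightarrow>
          exchange_digraph \<I> B B' `` {w} \<inter> R \<noteq> {}"
        using that by (meson not_less)
      have "yields (indep \<I>) (probe k L H w K (L - H)) (length ws * Suc k + K * (k + 2)) ?P"
        by (rule yields_mono[OF probe_yields[OF LH(1-3) cLH(1) order_refl]])
          (use small[unfolded nbrs] u' in \<open>auto simp: LH(4)\<close>)
      then show ?thesis by (simp add: None)
    next
      case (Some u)
      then have u: "u \<in> R" "(w, u) \<in> exchange_arcs \<I> L H" using r arc by auto
      then have "(w, u) \<in> exchange_digraph \<I> B B'"
        unfolding LH(4) unfolding exchange_digraph_def by simp
      then have "yields (indep \<I>) (scan K k B B' R (insert (w, u) E) ws) (length ws * Suc k + K * (k + 2)) ?P"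
        using Cons.prems u by (intro Cons.IH) auto
      then show ?thesis by (simp add: Some)
    qed
  qed
qed

end

text \<open>The lists model \<open>K\<close> independent uniform draws with replacement. With
  \<open>d = card D\<close>, each draw avoids a given set of more than \<open>K\<close> elements
  with probability at most \<open>1 - K/d\<close>, hence at most \<open>exp (- K/d)\<close>. A union
  bound over \<open>w\<close> gives the factor \<open>d\<close>.\<close>

lemma miss_large_set_prob:
  assumes D: "finite D" "D \<noteq> {}" and N: "\<And>w. w \<in> D \<Longrightarrow> N w \<subseteq> D"
  shows "measure_pmf.prob (pmf_of_set {ws. set ws \<subseteq> D \<and> length ws = K})
      {ws. \<exists>w\<in>D. K < card (N w) \<and> N w \<inter> set ws = {}}
    \<le> card D * exp (- (real K)\<^sup>2 / card D)"
proof -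
  let ?S = "{ws. set ws \<subseteq> D \<and> length ws = K}" and ?d = "real (card D)"
  let ?p = "pmf_of_set ?S"
  have d: "?d > 0" using D by (simp add: card_gt_0_iff)
  have cS: "card ?S = card D ^ K" and fS: "finite ?S"
    using card_lists_length_eq[OF D(1)] finite_lists_length_eq[OF D(1)] by auto
  then have S: "?S \<noteq> {}" using d by force
  have one: "measure_pmf.prob ?p {ws. N w \<inter> set ws = {}} \<le> exp (- (real K)\<^sup>2 / ?d)"
    if w: "w \<in> D" and K: "K < card (N w)" for w
  proof -
    have cN: "card (N w) \<le> card D" using N[OF w] D(1) by (rule card_mono[rotated])
    have "?S \<inter> {ws. N w \<inter> set ws = {}} = {ws. set ws \<subseteq> D - N w \<and> length ws = K}" by auto
    then have "card (?S \<inter> {ws. N w \<inter> set ws = {}}) = (card D - card (N w)) ^ K"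
      using D(1) N[OF w] by (simp add: card_lists_length_eq card_Diff_subset finite_subset)
    then have "measure_pmf.prob ?p {ws. N w \<inter> set ws = {}} = ((?d - card (N w)) / ?d) ^ K"
      using measure_pmf_of_set[OF S fS] cS cN by (simp add: power_divide of_nat_diff)
    also have "\<dots> \<le> exp (- (real K / ?d)) ^ K"
    proof (rule power_mono)
      have "(?d - card (N w)) / ?d \<le> 1 + - (real K / ?d)" using K d by (simp add: field_simps)
      also have "\<dots> \<le> exp (- (real K / ?d))" by (rule exp_ge_add_one_self)
      finally show "(?d - card (N w)) / ?d \<le> exp (- (real K / ?d))" .
    qed (use cN in simp)
    also have "\<dots> = exp (- (real K)\<^sup>2 / ?d)"
      by (simp add: exp_of_nat_mult[symmetric] power2_eq_square)
    finally show ?thesis .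
  qed
  define W where "W = {w\<in>D. K < card (N w)}"
  have "measure_pmf.prob ?p {ws. \<exists>w\<in>D. K < card (N w) \<and> N w \<inter> set ws = {}}
      = measure_pmf.prob ?p (\<Union>w\<in>W. {ws. N w \<inter> set ws = {}})"
    by (rule arg_cong[where f = "measure_pmf.prob ?p"]) (auto simp: W_def)
  also have "\<dots> \<le> (\<Sum>w\<in>W. measure_pmf.prob ?p {ws. N w \<inter> set ws = {}})"
    using D by (intro measure_pmf.finite_measure_subadditive_finite) (auto simp: W_def)
  also have "\<dots> \<le> (\<Sum>w\<in>W. exp (- (real K)\<^sup>2 / ?d))"
    using one by (intro sum_mono) (auto simp: W_def)
  also have "\<dots> \<le> ?d * exp (- (real K)\<^sup>2 / ?d)"
    using card_mono[of D W] D by (auto simp: W_def intro!: mult_right_mono)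
  finally show ?thesis .
qed

section \<open>Merging bases along random arcs\<close>

definition weighted_pmf :: "('b \<Rightarrow> real) \<Rightarrow> 'b set \<Rightarrow> 'b pmf" where
  "weighted_pmf c S = embed_pmf (\<lambda>e. if e \<in> S then c e / sum c S else 0)"

lemma pmf_weighted_pmf:
  assumes "finite S" "S \<noteq> {}" "\<And>e. e \<in> S \<Longrightarrow> 0 < c e"
  shows "pmf (weighted_pmf c S) e = (if e \<in> S then c e / sum c S else 0)"
proof -
  have pos: "0 < sum c S" using assms by (intro sum_pos) auto
  have "(\<integral>\<^sup>+e. ennreal (if e \<in> S then c e / sum c S else 0) \<partial>count_space UNIV)
      = (\<Sum>e\<in>S. ennreal (c e / sum c S))"
    using assms by (subst nn_integral_count_space'[of S]) auto
  also have "\<dots> = ennreal (\<Sum>e\<in>S. c e / sum c S)"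
    using assms pos by (intro sum_ennreal) (auto intro: less_imp_le)
  also have "(\<Sum>e\<in>S. c e / sum c S) = 1"
    using pos by (simp add: sum_divide_distrib[symmetric])
  finally show ?thesis
    unfolding weighted_pmf_def using assms pos
    by (subst pmf_embed_pmf) (auto intro: less_imp_le)
qed

lemma set_weighted_pmf:
  assumes "finite S" "S \<noteq> {}" "\<And>e. e \<in> S \<Longrightarrow> 0 < c e"
  shows "set_pmf (weighted_pmf c S) = S"
proof -
  have "0 < sum c S" using assms by (intro sum_pos) auto
  with assms show ?thesis
    by (auto simp: set_pmf_iff pmf_weighted_pmf[OF assms] less_imp_neq[symmetric] dest: less_imp_neq
        split: if_splits)
qed

text \<open>An arc whose source lies in \<open>B\<close> is an exchange in \<open>B'\<close>, and
  vice versa, so the source alone decides which basis changes.\<close>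

definition swap_arc :: "'a set \<Rightarrow> 'a set \<Rightarrow> 'a \<times> 'a \<Rightarrow> 'a set \<times> 'a set" where
  "swap_arc B B' e = (if fst e \<in> B then (B, insert (fst e) B' - {snd e}) else (insert (fst e) B - {snd e}, B'))"

text \<open>Swapping along an arc into \<open>w\<close> moves the point by the weight of the basis lacking \<open>w\<close>, so
  arcs are drawn with probability inversely proportional to that weight. Equal bases are returned
  in case of failure.\<close>

definition step :: "nat \<Rightarrow> nat \<Rightarrow> real \<Rightarrow> real \<Rightarrow> 'a set \<Rightarrow> 'a set \<Rightarrow> ('a, 'a set \<times> 'a set) oracle_alg" where
  "step K k b b' B B' =
    (if b = 0 then Return (B', B') else if b' = 0 then Return (B, B) else
     bind_alg (sample (pmf_of_set {ws. set ws \<subseteq> (B - B') \<union> (B' - B) \<and> length ws = K})) (\<lambda>ws.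
     bind_alg (scan K k B B' (set ws) {} ws) (\<lambda>es.
       if es = {} then Return (B, B)
       else bind_alg (sample (weighted_pmf (\<lambda>e. 1 / (if fst e \<in> B then b' else b)) es))
         (\<lambda>e. Return (swap_arc B B' e)))))"

text \<open>\<open>n\<close> is fuel: every step shrinks the difference of the bases, so they agree
  at the end if \<open>n\<close> is at least the size of the initial difference.\<close>

primrec merge :: "nat \<Rightarrow> nat \<Rightarrow> real \<Rightarrow> real \<Rightarrow> nat \<Rightarrow> 'a set \<times> 'a set \<Rightarrow> ('a, 'a set) oracle_alg" where
  "merge K k b b' 0 C = Return (fst C)"
| "merge K k b b' (Suc n) C =
    (if fst C = snd C then Return (fst C)
     else bind_alg (step K k b b' (fst C) (snd C)) (merge K k b b' n))"

text \<open>\<open>b\<close> is the total weight already collapsed onto the current basis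
  \<open>B\<close>.\<close>

primrec merge_all :: "nat \<Rightarrow> nat \<Rightarrow> real \<Rightarrow> 'a set \<Rightarrow> (real \<times> 'a set) list \<Rightarrow> ('a, 'a set) oracle_alg" where
  "merge_all K k b B [] = Return B"
| "merge_all K k b B (c # cs) =
    bind_alg (merge K k b (fst c) (card (B - snd c)) (B, snd c))
      (\<lambda>C. merge_all K k (b + fst c) C cs)"

text \<open>\<open>tail\<close> caps the failure probability of one step by \<open>\<delta>\<close>,
  where \<open>2 * r\<close> bounds the symmetric difference of two bases. The depth
  \<open>k\<close> suffices for a binary search in any basis.\<close>

locale rounding =
  fixes V :: "'a set" and \<I> :: "'a set set" and f :: "'a set \<Rightarrow> real" and r K k :: nat and \<delta> :: real
  assumes M: "matroid V \<I>" and rank: "\<And>B. basis \<I> B \<Longrightarrow> card B = r" and k: "r \<le> 2 ^ k"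
    and K: "0 < K" and \<delta>: "0 \<le> \<delta>" "\<delta> \<le> 1"
    and tail: "2 * real r * exp (- (real K)\<^sup>2 / (2 * real r)) \<le> \<delta>"
    and sub: "submodular_on V f" and nonneg: "\<And>S. S \<subseteq> V \<Longrightarrow> 0 \<le> f S"
begin

text \<open>\<open>y\<close> is the contribution of the bases still to be merged; it stays fixed
  while two bases are merged.\<close>

definition point :: "real \<Rightarrow> real \<Rightarrow> ('a \<Rightarrow> real) \<Rightarrow> 'a set \<times> 'a set \<Rightarrow> 'a \<Rightarrow> real" where
  "point b b' y C = (\<lambda>v. b * indicator (fst C) v + b' * indicator (snd C) v + y v)"

abbreviation "\<Phi> b b' y C \<equiv> multilinear_extension V f (point b b' y C)"

lemma finite_V: "finite V"
  using M by (simp add: matroid_def)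

lemma basis_carrier: "basis \<I> B \<Longrightarrow> B \<subseteq> V"
  using M matroid_carrier basis_indep by metis

lemma finite_basis: "basis \<I> B \<Longrightarrow> finite B"
  using basis_carrier finite_V finite_subset by metis

lemma basis_Diff_card_le: "basis \<I> B \<Longrightarrow> card (B - A) \<le> r"
  by (metis Diff_subset card_mono finite_basis rank)

lemma swap_arc_basis:
  assumes B: "basis \<I> B" and B': "basis \<I> B'" and e: "e \<in> exchange_digraph \<I> B B'"
  shows "basis \<I> (fst (swap_arc B B' e))" "basis \<I> (snd (swap_arc B B' e))"
    "card (fst (swap_arc B B' e) - snd (swap_arc B B' e)) < card (B - B')"
proof -
  obtain w u where wu: "e = (w, u)" by (cases e)
  note fin = finite_basis[OF B] finite_basis[OF B']
  consider "(w, u) \<in> exchange_arcs \<I> B B'" | "(w, u) \<in> exchange_arcs \<I> B' B"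
    using e by (auto simp: wu exchange_digraph_def)
  then have "basis \<I> (fst (swap_arc B B' e)) \<and> basis \<I> (snd (swap_arc B B' e)) \<and>
    card (fst (swap_arc B B' e) - snd (swap_arc B B' e)) < card (B - B')"
  proof cases
    case 1
    then have "insert w B - {u} - B' \<subset> B - B'" by (auto simp: exchange_arcs_def)
    then show ?thesis
      using 1 B B' exchange_arcs_basis[OF M B 1] fin
      by (auto simp: swap_arc_def wu exchange_arcs_def intro: psubset_card_mono)
  next
    case 2
    then have "B - (insert w B' - {u}) \<subset> B - B'" by (auto simp: exchange_arcs_def)
    then show ?thesis
      using 2 B B' exchange_arcs_basis[OF M B' 2] fin
      by (auto simp: swap_arc_def wu exchange_arcs_def intro: psubset_card_mono)
  qed
  then show "basis \<I> (fst (swap_arc B B' e))" "basis \<I> (snd (swap_arc B B' e))"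
    "card (fst (swap_arc B B' e) - snd (swap_arc B B' e)) < card (B - B')" by auto
qed

context
  fixes b b' :: real and y :: "'a \<Rightarrow> real"
  assumes b: "0 \<le> b" "0 \<le> b'" and y: "\<And>v. v \<in> V \<Longrightarrow> 0 \<le> y v \<and> b + b' + y v \<le> 1"
begin

lemma point_bounds:
  assumes "v \<in> V"
  shows "0 \<le> point b b' y C v \<and> point b b' y C v \<le> 1"
  using b y[OF assms] unfolding point_def indicator_def by (simp split: if_splits; linarith)

lemma \<Phi>_nonneg: "0 \<le> \<Phi> b b' y C"
  using nonneg point_bounds by (rule multilinear_extension_nonneg)

text \<open>The swap raises the coordinate of the source and lowers that of the target by the weight
  of the changed basis, so the tangent inequality applies.\<close>

lemma \<Phi>_swap_arc:
  assumes B: "basis \<I> B" and B': "basis \<I> B'" and e: "e \<in> exchange_digraph \<I> B B'"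
  shows "\<Phi> b b' y (B, B') + (if fst e \<in> B then b' else b) *
      (multilinear_deriv V f (point b b' y (B, B')) (fst e) - multilinear_deriv V f (point b b' y (B, B')) (snd e))
    \<le> \<Phi> b b' y (swap_arc B B' e)"
proof -
  obtain w u where wu: "e = (w, u)" by (cases e)
  have V: "B \<subseteq> V" "B' \<subseteq> V" using basis_carrier B B' by auto
  consider "(w, u) \<in> exchange_arcs \<I> B B'" | "(w, u) \<in> exchange_arcs \<I> B' B"
    using e by (auto simp: wu exchange_digraph_def)
  then show ?thesis
  proof cases
    case 1
    show ?thesis
      using 1 V
      by (intro multilinear_extension_tangent[OF finite_V sub _ _ _ point_bounds])
        (auto simp: wu exchange_arcs_def swap_arc_def point_def indicator_def algebra_simps)
  next
    case 2
    show ?thesis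
      using 2 V
      by (intro multilinear_extension_tangent[OF finite_V sub _ _ _ point_bounds])
        (auto simp: wu exchange_arcs_def swap_arc_def point_def indicator_def algebra_simps)
  qed
qed

text \<open>The expected displacement along a balanced set of arcs vanishes.\<close>

lemma \<Phi>_balanced:
  assumes B: "basis \<I> B" and B': "basis \<I> B'" and pos: "0 < b" "0 < b'"
    and es: "es \<subseteq> exchange_digraph \<I> B B'" "balanced es" "es \<noteq> {}"
  shows "ennreal (\<Phi> b b' y (B, B')) \<le>
    (\<integral>\<^sup>+ e. ennreal (\<Phi> b b' y (swap_arc B B' e))
      \<partial>measure_pmf (weighted_pmf (\<lambda>e. 1 / (if fst e \<in> B then b' else b)) es))"
proof -
  define c where "c e = 1 / (if fst e \<in> B then b' else b)" for e :: "'a \<times> 'a"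
  define g where "g = multilinear_deriv V f (point b b' y (B, B'))"
  have "es \<subseteq> (B \<union> B') \<times> (B \<union> B')"
    using es(1) by (auto simp: exchange_digraph_def exchange_arcs_def)
  then have fin: "finite es" using finite_basis[OF B] finite_basis[OF B'] finite_subset by blast
  have c: "0 < c e" for e using pos by (simp add: c_def)
  have sum: "0 < sum c es" using fin es(3) c by (intro sum_pos) auto
  note set = set_weighted_pmf[OF fin es(3) c]
  \<comment> \<open>The added sum is zero. It is spread over the arcs as first-order terms, since
    probability times step length is \<open>1 / sum c es\<close> for every arc.\<close>
  have "\<Phi> b b' y (B, B') = (\<Sum>e\<in>es. c e / sum c es * \<Phi> b b' y (B, B')) +
      (\<Sum>(w, u)\<in>es. g w - g u) / sum c es"
    using sum balanced_sum_eq_0[OF es(2), of g]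
    by (simp add: sum_distrib_right[symmetric] sum_divide_distrib[symmetric])
  also have "\<dots> = (\<Sum>e\<in>es. c e / sum c es * (\<Phi> b b' y (B, B') +
      (if fst e \<in> B then b' else b) * (g (fst e) - g (snd e))))"
    unfolding sum_divide_distrib sum.distrib[symmetric]
  proof (intro sum.cong refl)
    fix e
    have "c e * (if fst e \<in> B then b' else b) = 1" using pos by (simp add: c_def)
    then have "c e / sum c es * ((if fst e \<in> B then b' else b) * (g (fst e) - g (snd e))) =
      (g (fst e) - g (snd e)) / sum c es"
      by (simp only: times_divide_eq_left mult.assoc[symmetric] mult_1)
    then show "c e / sum c es * \<Phi> b b' y (B, B') + (case e of (w, u) \<Rightarrow> g w - g u) / sum c es =
      c e / sum c es * (\<Phi> b b' y (B, B') + (if fst e \<in> B then b' else b) * (g (fst e) - g (snd e)))"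
      by (simp only: distrib_left case_prod_unfold)
  qed
  also have "\<dots> \<le> (\<Sum>e\<in>es. c e / sum c es * \<Phi> b b' y (swap_arc B B' e))"
    unfolding g_def
  proof (intro sum_mono mult_left_mono)
    fix e assume "e \<in> es"
    then show "\<Phi> b b' y (B, B') + (if fst e \<in> B then b' else b) *
        (multilinear_deriv V f (point b b' y (B, B')) (fst e) - multilinear_deriv V f (point b b' y (B, B')) (snd e))
      \<le> \<Phi> b b' y (swap_arc B B' e)"
      using es(1) by (intro \<Phi>_swap_arc[OF B B']) auto
    show "0 \<le> c e / sum c es" using c[of e] sum by simp
  qed
  also have "\<dots> = (\<Sum>e\<in>es. \<Phi> b b' y (swap_arc B B' e) * pmf (weighted_pmf c es) e)"
    by (intro sum.cong) (auto simp: pmf_weighted_pmf[OF fin es(3) c])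
  finally have "ennreal (\<Phi> b b' y (B, B')) \<le>
      ennreal (\<Sum>e\<in>es. \<Phi> b b' y (swap_arc B B' e) * pmf (weighted_pmf c es) e)"
    by (rule ennreal_leI)
  also have "\<dots> = (\<Sum>e\<in>es. ennreal (\<Phi> b b' y (swap_arc B B' e)) * ennreal (pmf (weighted_pmf c es) e))"
    using \<Phi>_nonneg by (simp add: sum_ennreal[symmetric] ennreal_mult)
  also have "\<dots> = (\<integral>\<^sup>+ e. ennreal (\<Phi> b b' y (swap_arc B B' e)) \<partial>measure_pmf (weighted_pmf c es))"
    using fin by (subst nn_integral_measure_pmf_finite) (auto simp: set)
  finally show ?thesis by (simp add: c_def[abs_def])
qed

lemma sample_scan_set:
  assumes B: "basis \<I> B" and B': "basis \<I> B'" and ne: "B \<noteq> B'"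
  shows "finite ((B - B') \<union> (B' - B))" "(B - B') \<union> (B' - B) \<noteq> {}"
    "set_pmf (pmf_of_set {ws. set ws \<subseteq> (B - B') \<union> (B' - B) \<and> length ws = K}) =
      {ws. set ws \<subseteq> (B - B') \<union> (B' - B) \<and> length ws = K}"
    "card ((B - B') \<union> (B' - B)) \<le> 2 * r"
proof -
  show D: "finite ((B - B') \<union> (B' - B))" "(B - B') \<union> (B' - B) \<noteq> {}"
    using finite_basis[OF B] finite_basis[OF B'] ne by auto
  then obtain a where "a \<in> (B - B') \<union> (B' - B)" by blast
  then have "replicate K a \<in> {ws. set ws \<subseteq> (B - B') \<union> (B' - B) \<and> length ws = K}" by auto
  then show "set_pmf (pmf_of_set {ws. set ws \<subseteq> (B - B') \<union> (B' - B) \<and> length ws = K}) =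
      {ws. set ws \<subseteq> (B - B') \<union> (B' - B) \<and> length ws = K}"
    using finite_lists_length_eq[OF D(1)] by (intro set_pmf_of_set) auto
  have "card ((B - B') \<union> (B' - B)) \<le> card (B - B') + card (B' - B)" by (rule card_Un_le)
  then show "card ((B - B') \<union> (B' - B)) \<le> 2 * r"
    using basis_Diff_card_le[OF B, of B'] basis_Diff_card_le[OF B', of B] by simp
qed

text \<open>\<open>K\<close> searches of \<open>k + 1\<close> queries, followed by at most
  \<open>K\<close> rounds of \<open>probe\<close> at \<open>k + 2\<close> queries each.\<close>

lemma scan_sample_yields:
  assumes B: "basis \<I> B" and B': "basis \<I> B'"
    and ws: "set ws \<subseteq> (B - B') \<union> (B' - B)" "length ws = K"
  shows "yields (indep \<I>) (scan K k B B' (set ws) {} ws) (K * (2 * k + 3)) (\<lambda>es.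
    es \<subseteq> exchange_digraph \<I> B B' \<and> balanced es \<and>
    ((\<forall>w\<in>(B - B') \<union> (B' - B). K < card (exchange_digraph \<I> B B' `` {w}) \<longrightarrow>
       exchange_digraph \<I> B B' `` {w} \<inter> set ws \<noteq> {}) \<longrightarrow> es \<noteq> {}))"
proof (rule yields_mono[OF scan_yields[OF M B B']])
  show "length ws * Suc k + K * (k + 2) \<le> K * (2 * k + 3)"
    using ws(2) by (simp add: algebra_simps)
qed (use ws K k rank[OF B] in auto)

text \<open>Failure makes progress too: it returns equal bases, whose difference is empty, whereas
  neither of two distinct bases contains the other.\<close>

lemma step_yields:
  assumes B: "basis \<I> B" and B': "basis \<I> B'" and ne: "B \<noteq> B'"
  shows "yields (indep \<I>) (step K k b b' B B') (K * (2 * k + 3))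
    (\<lambda>C. basis \<I> (fst C) \<and> basis \<I> (snd C) \<and> card (fst C - snd C) < card (B - B'))"
    (is "yields _ _ _ ?P")
proof -
  have "B - B' \<noteq> {}"
    using B B' ne by (auto simp: basis_def)
  then have pos: "0 < card (B - B')" using finite_basis[OF B] by (simp add: card_gt_0_iff)
  have "yields (indep \<I>) (bind_alg (sample (pmf_of_set {ws. set ws \<subseteq> (B - B') \<union> (B' - B) \<and> length ws = K})) (\<lambda>ws.
     bind_alg (scan K k B B' (set ws) {} ws) (\<lambda>es.
       if es = {} then Return (B, B)
       else bind_alg (sample (weighted_pmf (\<lambda>e. 1 / (if fst e \<in> B then b' else b)) es))
         (\<lambda>e. Return (swap_arc B B' e))))) (0 + (K * (2 * k + 3) + (0 + 0))) ?P" if "0 < b" "0 < b'"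
  proof (intro yields_bind[OF yields_sample], assumption)
    fix ws assume "ws \<in> set_pmf (pmf_of_set {ws. set ws \<subseteq> (B - B') \<union> (B' - B) \<and> length ws = K})"
    then have ws: "set ws \<subseteq> (B - B') \<union> (B' - B)" "length ws = K"
      unfolding sample_scan_set(3)[OF B B' ne] by auto
    show "yields (indep \<I>) (bind_alg (scan K k B B' (set ws) {} ws) (\<lambda>es.
       if es = {} then Return (B, B)
       else bind_alg (sample (weighted_pmf (\<lambda>e. 1 / (if fst e \<in> B then b' else b)) es))
         (\<lambda>e. Return (swap_arc B B' e)))) (K * (2 * k + 3) + (0 + 0)) ?P"
    proof (rule yields_bind[OF scan_sample_yields[OF B B' ws]], goal_cases)
      case (1 es)
      show ?case
      proof (cases "es = {}")
        case True
        then show ?thesis using B pos by (simp add: yields_Return)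
      next
        case False
        have "es \<subseteq> (B \<union> B') \<times> (B \<union> B')"
          using 1 by (auto simp: exchange_digraph_def exchange_arcs_def)
        then have "finite es" using finite_basis[OF B] finite_basis[OF B'] finite_subset by blast
        then have "set_pmf (weighted_pmf (\<lambda>e. 1 / (if fst e \<in> B then b' else b)) es) = es"
          using False that by (intro set_weighted_pmf) auto
        then have "yields (indep \<I>) (bind_alg (sample (weighted_pmf (\<lambda>e. 1 / (if fst e \<in> B then b' else b)) es))
            (\<lambda>e. Return (swap_arc B B' e))) (0 + 0) ?P"
          using 1 swap_arc_basis[OF B B']
          by (intro yields_bind[OF yields_sample[where P = "\<lambda>e. e \<in> es"]] yields_Return) auto
        then show ?thesis using False by simp
      qed
    qed
  qed
  then show ?thesis
    using b B B' pos by (auto simp: step_def yields_Return)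
qed

text \<open>Only samples hitting all large out-neighbourhoods are counted. For these the scan finds
  a cycle and \<open>\<Phi>_balanced\<close> applies; the others have probability at most
  \<open>\<delta>\<close> and contribute at least zero, as \<open>f\<close> is nonnegative.\<close>

lemma step_expect:
  assumes B: "basis \<I> B" and B': "basis \<I> B'" and ne: "B \<noteq> B'"
  shows "ennreal (1 - \<delta>) * ennreal (\<Phi> b b' y (B, B')) \<le>
    expect (indep \<I>) (step K k b b' B B') (\<lambda>C. ennreal (\<Phi> b b' y C))"
proof (cases "b = 0 \<or> b' = 0")
  case True
  \<comment> \<open>A basis of weight zero does not affect the point, so discarding it preserves the
    value exactly.\<close>
  have "ennreal (1 - \<delta>) * ennreal (\<Phi> b b' y (B, B')) \<le> 1 * ennreal (\<Phi> b b' y (B, B'))"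
    using \<delta> by (intro mult_right_mono) (auto simp: ennreal_le_1)
  also have "\<dots> = expect (indep \<I>) (step K k b b' B B') (\<lambda>C. ennreal (\<Phi> b b' y C))"
    using True by (auto simp: step_def point_def)
  finally show ?thesis .
next
  case False
  then have pos: "0 < b" "0 < b'" using b by auto
  define D where "D = (B - B') \<union> (B' - B)"
  define out where "out w = exchange_digraph \<I> B B' `` {w}" for w
  define p where "p = pmf_of_set {ws. set ws \<subseteq> D \<and> length ws = K}"
  define bad where "bad = {ws. \<exists>w\<in>D. K < card (out w) \<and> out w \<inter> set ws = {}}"
  note D = sample_scan_set[OF B B' ne, folded D_def]
  have d: "0 < real (card D)" using D by (simp add: card_gt_0_iff)
  have "measure_pmf.prob p bad \<le> card D * exp (- (real K)\<^sup>2 / card D)"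
    unfolding p_def bad_def
    by (intro miss_large_set_prob D(1,2))
      (auto simp: out_def D_def exchange_digraph_def exchange_arcs_def)
  \<comment> \<open>The bound increases with the number of vertices, which is at most
    \<open>2 * r\<close>.\<close>
  also have "\<dots> \<le> 2 * real r * exp (- (real K)\<^sup>2 / (2 * real r))"
    using d D(4) by (intro mult_mono) (auto intro!: divide_left_mono simp flip: of_nat_mult)
  also have "\<dots> \<le> \<delta>" by (rule tail)
  finally have "1 - \<delta> \<le> measure_pmf.prob p (- bad)"
    using measure_pmf.prob_compl[of bad p] by (simp add: Compl_eq_Diff_UNIV)
  then have "ennreal (1 - \<delta>) * ennreal (\<Phi> b b' y (B, B')) \<le>
      emeasure (measure_pmf p) (- bad) * ennreal (\<Phi> b b' y (B, B'))"
    by (intro mult_right_mono) (auto simp: measure_pmf.emeasure_eq_measure ennreal_leI)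
  also have "\<dots> = (\<integral>\<^sup>+ ws. indicator (- bad) ws * ennreal (\<Phi> b b' y (B, B')) \<partial>measure_pmf p)"
    by (simp add: nn_integral_multc)
  also have "\<dots> \<le> (\<integral>\<^sup>+ ws. expect (indep \<I>) (bind_alg (scan K k B B' (set ws) {} ws) (\<lambda>es.
       if es = {} then Return (B, B)
       else bind_alg (sample (weighted_pmf (\<lambda>e. 1 / (if fst e \<in> B then b' else b)) es))
         (\<lambda>e. Return (swap_arc B B' e)))) (\<lambda>C. ennreal (\<Phi> b b' y C)) \<partial>measure_pmf p)"
  proof (intro nn_integral_mono_AE, unfold AE_measure_pmf_iff, intro ballI)
    fix ws assume "ws \<in> set_pmf p"
    then have ws: "set ws \<subseteq> D" "length ws = K" unfolding p_def D(3) by auto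
    note scan = scan_sample_yields[OF B B' ws[unfolded D_def], folded D_def out_def]
    show "indicator (- bad) ws * ennreal (\<Phi> b b' y (B, B')) \<le>
      expect (indep \<I>) (bind_alg (scan K k B B' (set ws) {} ws) (\<lambda>es.
       if es = {} then Return (B, B)
       else bind_alg (sample (weighted_pmf (\<lambda>e. 1 / (if fst e \<in> B then b' else b)) es))
         (\<lambda>e. Return (swap_arc B B' e)))) (\<lambda>C. ennreal (\<Phi> b b' y C))"
    proof (cases "ws \<in> bad")
      case False
      show ?thesis unfolding expect_bind
      proof (rule expect_ge[OF scan], goal_cases)
        case (1 es)
        with False have "es \<noteq> {}" by (auto simp: bad_def)
        then show ?case
          using \<Phi>_balanced[OF B B' pos, of es] 1 False
          by (simp add: expect_bind expect_sample)
      qed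
    qed simp
  qed
  also have "\<dots> = expect (indep \<I>) (step K k b b' B B') (\<lambda>C. ennreal (\<Phi> b b' y C))"
    using False by (simp add: step_def expect_bind expect_sample p_def D_def)
  finally show ?thesis .
qed

lemma merge_yields:
  assumes "basis \<I> (fst C)" "basis \<I> (snd C)"
  shows "yields (indep \<I>) (merge K k b b' n C) (n * (K * (2 * k + 3))) (basis \<I>)"
  using assms
proof (induction n arbitrary: C)
  case (Suc n)
  show ?case
  proof (cases "fst C = snd C")
    case False
    then show ?thesis using Suc
      by (auto intro!: yields_bind[OF step_yields])
  qed (use Suc in \<open>simp add: yields_Return\<close>)
qed (simp add: yields_Return)

text \<open>Each step costs one factor \<open>1 - \<delta>\<close>. If the bases agree early, the
  remaining factors only lower the left-hand side.\<close>

lemma merge_expect: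
  assumes "basis \<I> (fst C)" "basis \<I> (snd C)" "card (fst C - snd C) \<le> n"
  shows "ennreal ((1 - \<delta>) ^ n) * ennreal (\<Phi> b b' y C) \<le>
    expect (indep \<I>) (merge K k b b' n C) (\<lambda>B. ennreal (\<Phi> b b' y (B, B)))"
  using assms
proof (induction n arbitrary: C)
  case 0
  \<comment> \<open>A basis contained in another equals it by maximality.\<close>
  then have "fst C = snd C"
    using finite_basis[of "fst C"] by (auto simp: basis_def)
  then show ?case by (cases C) simp
next
  case (Suc n)
  show ?case
  proof (cases "fst C = snd C")
    case True
    have "ennreal ((1 - \<delta>) ^ Suc n) * ennreal (\<Phi> b b' y C) \<le> 1 * ennreal (\<Phi> b b' y C)"
      using \<delta> by (intro mult_right_mono) (auto simp del: power_Suc simp: ennreal_le_1 power_le_one)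
    then show ?thesis using True by (cases C) simp
  next
    case False
    have "ennreal ((1 - \<delta>) ^ Suc n) * ennreal (\<Phi> b b' y C) =
        ennreal ((1 - \<delta>) ^ n) * (ennreal (1 - \<delta>) * ennreal (\<Phi> b b' y (fst C, snd C)))"
      using \<delta> by (simp add: ennreal_mult mult_ac)
    also have "\<dots> \<le> ennreal ((1 - \<delta>) ^ n) *
        expect (indep \<I>) (step K k b b' (fst C) (snd C)) (\<lambda>C. ennreal (\<Phi> b b' y C))"
      using Suc.prems False by (intro mult_left_mono step_expect) auto
    also have "\<dots> \<le> expect (indep \<I>) (step K k b b' (fst C) (snd C))
        (\<lambda>C. expect (indep \<I>) (merge K k b b' n C) (\<lambda>B. ennreal (\<Phi> b b' y (B, B))))"
      using Suc.prems False by (intro expect_mono[OF step_yields] Suc.IH) auto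
    finally show ?thesis using False by (simp add: expect_bind)
  qed
qed

end

section \<open>Merging the whole list of bases\<close>

lemma merge_all_yields:
  assumes "basis \<I> B" "0 \<le> b" "\<And>c. c \<in> set cs \<Longrightarrow> 0 \<le> fst c \<and> basis \<I> (snd c)"
    and "b + (\<Sum>c\<leftarrow>cs. fst c) = 1"
  shows "yields (indep \<I>) (merge_all K k b B cs) (length cs * (r * (K * (2 * k + 3)))) (basis \<I>)"
  using assms
proof (induction cs arbitrary: b B)
  case (Cons c cs)
  have c: "0 \<le> fst c" "basis \<I> (snd c)" using Cons.prems(3) by auto
  have "0 \<le> (\<Sum>c\<leftarrow>cs. fst c)" using Cons.prems(3) by (intro sum_list_nonneg) auto
  then have "b + fst c \<le> 1" using Cons.prems(4) by simp
  have bc: "0 \<le> b + fst c" using Cons.prems(2) c by simp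
  \<comment> \<open>The claim does not mention the point, so \<open>y\<close> is taken to be
    zero.\<close>
  have "yields (indep \<I>) (merge K k b (fst c) (card (B - snd c)) (B, snd c))
      (card (B - snd c) * (K * (2 * k + 3))) (basis \<I>)"
    using Cons.prems c \<open>b + fst c \<le> 1\<close> by (intro merge_yields[where y = "\<lambda>_. 0"]) auto
  then have "yields (indep \<I>) (merge K k b (fst c) (card (B - snd c)) (B, snd c))
      (r * (K * (2 * k + 3))) (basis \<I>)"
    by (rule yields_mono) (intro mult_le_mono1 basis_Diff_card_le Cons.prems(1))
  then have "yields (indep \<I>) (merge_all K k b B (c # cs))
      (r * (K * (2 * k + 3)) + length cs * (r * (K * (2 * k + 3)))) (basis \<I>)"
    unfolding merge_all.simps
    by (rule yields_bind) (use Cons.prems c in \<open>auto intro!: Cons.IH bc\<close>)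
  then show ?case by simp
qed (simp add: yields_Return)

text \<open>Merging the current basis with the head of the list leaves a point of the same form,
  with their combined weight on one basis. Each merge takes at most \<open>r\<close> steps, whence
  the exponent.\<close>

lemma merge_all_expect:
  assumes "basis \<I> B" "0 \<le> b" "\<And>c. c \<in> set cs \<Longrightarrow> 0 \<le> fst c \<and> basis \<I> (snd c)"
    and "b + (\<Sum>c\<leftarrow>cs. fst c) = 1"
  shows "ennreal ((1 - \<delta>) ^ (length cs * r)) *
      ennreal (multilinear_extension V f (\<lambda>v. b * indicator B v + (\<Sum>c\<leftarrow>cs. fst c * indicator (snd c) v)))
    \<le> expect (indep \<I>) (merge_all K k b B cs) (\<lambda>S. ennreal (f S))"
  using assms
proof (induction cs arbitrary: b B)
  case Nil
  then have "multilinear_extension V f (\<lambda>v. b * indicator B v) = f B"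
    using multilinear_extension_indicator[OF finite_V basis_carrier] by simp
  then show ?case by simp
next
  case (Cons c cs)
  define y where "y v = (\<Sum>c\<leftarrow>cs. fst c * indicator (snd c) v)" for v
  define n where "n = card (B - snd c)"
  have c: "0 \<le> fst c" "basis \<I> (snd c)" using Cons.prems(3) by auto
  have "0 \<le> fst c'" if "c' \<in> set cs" for c' using Cons.prems(3) that by auto
  then have y0: "0 \<le> y v" for v
    unfolding y_def by (intro sum_list_nonneg) fastforce
  define s where "s = (\<Sum>c\<leftarrow>cs. fst c)"
  \<comment> \<open>As all weights add up to 1, this keeps every point met during the merge in the
    unit cube.\<close>
  have "y v \<le> s" for v
    unfolding y_def s_def using Cons.prems(3) by (intro sum_list_mono) (auto simp: indicator_def)
  moreover have "b + fst c + s = 1" using Cons.prems(4) by (simp add: s_def add.assoc)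
  ultimately have y1: "b + fst c + y v \<le> 1" for v by (metis add_left_mono)
  have pt: "(\<lambda>v. b * indicator B v + (\<Sum>c\<leftarrow>c # cs. fst c * indicator (snd c) v)) = point b (fst c) y (B, snd c)"
    by (simp add: point_def y_def add.assoc)
  have pt': "(\<lambda>v. (b + fst c) * indicator C v + (\<Sum>c\<leftarrow>cs. fst c * indicator (snd c) v)) = point b (fst c) y (C, C)"
    for C by (simp add: point_def y_def distrib_right)
  have mono: "(1 - \<delta>) ^ r \<le> (1 - \<delta>) ^ n"
    using \<delta> basis_Diff_card_le[OF Cons.prems(1)] by (intro power_decreasing) (auto simp: n_def)
  have "ennreal ((1 - \<delta>) ^ (length (c # cs) * r)) * ennreal (\<Phi> b (fst c) y (B, snd c)) =
      ennreal ((1 - \<delta>) ^ (length cs * r)) * (ennreal ((1 - \<delta>) ^ r) * ennreal (\<Phi> b (fst c) y (B, snd c)))"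
    using \<delta> by (simp add: power_add ennreal_mult mult_ac)
  also have "\<dots> \<le> ennreal ((1 - \<delta>) ^ (length cs * r)) *
      (ennreal ((1 - \<delta>) ^ n) * ennreal (\<Phi> b (fst c) y (B, snd c)))"
    using mono by (intro mult_left_mono mult_right_mono ennreal_leI) auto
  also have "\<dots> \<le> ennreal ((1 - \<delta>) ^ (length cs * r)) *
      expect (indep \<I>) (merge K k b (fst c) n (B, snd c)) (\<lambda>C. ennreal (\<Phi> b (fst c) y (C, C)))"
    using Cons.prems c y0 y1 by (intro mult_left_mono merge_expect) (auto simp: n_def)
  also have "\<dots> \<le> expect (indep \<I>) (merge K k b (fst c) n (B, snd c))
      (\<lambda>C. expect (indep \<I>) (merge_all K k (b + fst c) C cs) (\<lambda>S. ennreal (f S)))"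
  proof (rule expect_mono[OF merge_yields[where y = y]])
    fix C assume C: "basis \<I> C"
    have "ennreal ((1 - \<delta>) ^ (length cs * r)) * ennreal (multilinear_extension V f
        (\<lambda>v. (b + fst c) * indicator C v + (\<Sum>c\<leftarrow>cs. fst c * indicator (snd c) v))) \<le>
      expect (indep \<I>) (merge_all K k (b + fst c) C cs) (\<lambda>S. ennreal (f S))"
      using C Cons.prems c by (intro Cons.IH) auto
    then show "ennreal ((1 - \<delta>) ^ (length cs * r)) * ennreal (\<Phi> b (fst c) y (C, C)) \<le>
      expect (indep \<I>) (merge_all K k (b + fst c) C cs) (\<lambda>S. ennreal (f S))"
      unfolding pt' .
  qed (use Cons.prems c y0 y1 in auto)
  finally show ?case unfolding pt by (simp add: expect_bind n_def)
qed

end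

section \<open>Parameters and query count\<close>

text \<open>The hypothesis is the conclusion solved for \<open>K\<close>. The target
  \<open>\<epsilon> / (r * t)\<close> lets all of the at most \<open>(t - 1) * r\<close> steps lose
  no more than \<open>\<epsilon>\<close> together.\<close>

lemma hitting_tail:
  assumes "1 \<le> r" "1 \<le> t" "0 < \<epsilon>" "2 * real r * ln (2 * (real r)\<^sup>2 * real t / \<epsilon>) \<le> (real K)\<^sup>2"
  shows "2 * real r * exp (- (real K)\<^sup>2 / (2 * real r)) \<le> \<epsilon> / (real r * real t)"
proof -
  have "- (real K)\<^sup>2 / (2 * real r) \<le> - ln (2 * (real r)\<^sup>2 * real t / \<epsilon>)"
    using assms by (simp add: field_simps)
  then have "exp (- (real K)\<^sup>2 / (2 * real r)) \<le> exp (- ln (2 * (real r)\<^sup>2 * real t / \<epsilon>))"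
    by simp
  also have "\<dots> = \<epsilon> / (2 * (real r)\<^sup>2 * real t)"
    using assms by (simp add: exp_minus exp_ln)
  finally have "2 * real r * exp (- (real K)\<^sup>2 / (2 * real r)) \<le> 2 * real r * (\<epsilon> / (2 * (real r)\<^sup>2 * real t))"
    by (intro mult_left_mono) auto
  also have "\<dots> = \<epsilon> / (real r * real t)"
    using assms by (simp add: power2_eq_square)
  finally show ?thesis .
qed

text \<open>The least positive integer reaching the threshold of \<open>hitting_tail\<close>;
  positivity keeps the sample nonempty.\<close>

definition sample_size :: "real \<Rightarrow> nat \<Rightarrow> nat \<Rightarrow> nat" where
  "sample_size \<epsilon> r t = max 1 (nat \<lceil>sqrt (2 * real r * ln (2 * (real r)\<^sup>2 * real t / \<epsilon>))\<rceil>)"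

definition search_depth :: "nat \<Rightarrow> nat" where
  "search_depth r = nat \<lceil>log 2 (real r)\<rceil>"

lemma sample_size_bound:
  assumes "1 \<le> r" "1 \<le> t" "0 < \<epsilon>" "\<epsilon> < 1"
  shows "2 * real r * ln (2 * (real r)\<^sup>2 * real t / \<epsilon>) \<le> (real (sample_size \<epsilon> r t))\<^sup>2"
proof -
  let ?a = "2 * real r * ln (2 * (real r)\<^sup>2 * real t / \<epsilon>)"
  have "sqrt ?a \<le> real (sample_size \<epsilon> r t)"
    unfolding sample_size_def by linarith
  moreover have "1 \<le> 2 * (real r)\<^sup>2 * real t / \<epsilon>"
  proof -
    have "1 * 1 \<le> (real r)\<^sup>2 * real t" using assms by (intro mult_mono) auto
    with assms show ?thesis by (simp add: field_simps)
  qed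
  ultimately show ?thesis
    using assms by (intro sqrt_le_D) auto
qed

lemma search_depth_bound: "r \<le> 2 ^ search_depth r"
proof (cases "r = 0")
  case False
  have "log 2 (real r) \<le> real (search_depth r)" unfolding search_depth_def by linarith
  then have "real r \<le> 2 powr real (search_depth r)" using False by (simp add: log_le_iff)
  then have "real r \<le> real (2 ^ search_depth r)" by (simp add: powr_realpow)
  then show ?thesis by linarith
qed simp

text \<open>Since \<open>t \<ge> 2\<close>, the logarithm \<open>L\<close> is at least
  \<open>ln 2\<close> and absorbs additive constants. The sample size is at most
  \<open>5 * sqrt (r * L)\<close> and the cost per sampled vertex at most \<open>12 * L\<close>,
  which yields 60.\<close>

lemma query_count_bound:
  assumes rt: "1 \<le> r" "2 \<le> t" and \<epsilon>: "0 < \<epsilon>" "\<epsilon> < 1"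
  shows "real (t * (r * (sample_size \<epsilon> r t * (2 * search_depth r + 3)))) \<le>
    60 * (real r powr (3/2) * real t * ln (real r * real t / \<epsilon>) powr (3/2))"
proof -
  define L where "L = ln (real r * real t / \<epsilon>)"
  have r: "1 \<le> real r" and t: "2 \<le> real t" using rt by auto
  have rtge: "2 \<le> real r * real t" using mult_mono[of 1 "real r" 2 "real t"] r t by simp
  have div: "z \<le> z / \<epsilon>" if "0 \<le> z" for z :: real 
    using that \<epsilon> mult_right_mono[of \<epsilon> 1 z] by (simp add: field_simps)
  have "ln 2 \<le> L" unfolding L_def using rtge div[of "real r * real t"] by (simp add: ln_mono)
  then have L: "2/3 \<le> L" using ln2_ge_two_thirds by linarith
  have "real r * 1 \<le> real r * real t" using r t by (intro mult_left_mono) auto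
  then have "real r \<le> real r * real t / \<epsilon>"
    using div[of "real r * real t"] by simp
  then have lnr: "ln (real r) \<le> L" unfolding L_def using r by (intro ln_mono) auto
  define A where "A = ln (2 * (real r)\<^sup>2 * real t / \<epsilon>)"
  have "ln (2 * (a * z)) = ln 2 + (ln a + ln z)" if "0 < a" "0 < z" for a z :: real
    using that by (simp add: ln_mult)
  moreover have "0 < real r * real t / \<epsilon>" using rtge \<epsilon> by simp
  ultimately have "ln (2 * (real r * (real r * real t / \<epsilon>))) = ln 2 + (ln (real r) + L)"
    unfolding L_def using r by (meson less_le_trans zero_less_one)
  moreover have "2 * (real r)\<^sup>2 * real t / \<epsilon> = 2 * (real r * (real r * real t / \<epsilon>))"
    by (simp add: power2_eq_square)
  ultimately have A: "A = ln 2 + (ln (real r) + L)" by (simp only: A_def)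
  \<comment> \<open>Each of the three summands of \<open>A\<close> is at most
    \<open>L\<close>.\<close>
  have "A \<le> 3 * L" using A \<open>ln 2 \<le> L\<close> lnr by simp
  then have "2 * real r * A \<le> 2 * real r * (3 * L)"
    using r by (intro mult_left_mono) auto
  then have up: "sqrt (2 * real r * A) \<le> sqrt (6 * (real r * L))"
    by (simp add: mult_ac)
  \<comment> \<open>The root below is at least 2, so doubling it absorbs the error 1 of rounding
    up.\<close>
  have "1 * (2/3) \<le> real r * L" using r L by (intro mult_mono) auto
  then have "2 \<le> sqrt (6 * (real r * L))" by (intro real_le_rsqrt) (simp add: mult_ac)
  moreover have "0 \<le> A" using A L r by simp
  then have "0 \<le> sqrt (2 * real r * A)" using r by simp
  then have "real (sample_size \<epsilon> r t) \<le> max 1 (sqrt (2 * real r * A) + 1)"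
    unfolding sample_size_def A_def[symmetric] by linarith
  ultimately have "real (sample_size \<epsilon> r t) \<le> 2 * sqrt (6 * (real r * L))" using up by linarith
  also have "\<dots> = 2 * sqrt 6 * sqrt (real r * L)" by (simp add: real_sqrt_mult)
  also have "\<dots> \<le> 2 * (5/2) * sqrt (real r * L)"
  proof -
    have "sqrt 6 \<le> (5/2 :: real)" by (rule real_le_lsqrt) (simp_all add: power2_eq_square)
    then show ?thesis using L r by (intro mult_right_mono) auto
  qed
  finally have K: "real (sample_size \<epsilon> r t) \<le> 5 * sqrt (real r * L)" by simp
  have "log 2 (real r) \<le> 3/2 * L"
  proof -
    have "ln (real r) \<le> L * 1" using lnr by simp
    also have "\<dots> \<le> L * (3/2 * ln 2)" using L ln2_ge_two_thirds by (intro mult_left_mono) auto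
    finally show ?thesis by (simp add: log_def field_simps)
  qed
  moreover have "0 \<le> log 2 (real r)" using r by simp
  ultimately have "real (search_depth r) \<le> 3/2 * L + 1" unfolding search_depth_def by linarith
  \<comment> \<open>The left side is at most \<open>3 * L + 5\<close>, and
    \<open>9 * L \<ge> 6\<close>.\<close>
  then have k: "real (2 * search_depth r + 3) \<le> 12 * L" using L by simp
  have "real (t * (r * (sample_size \<epsilon> r t * (2 * search_depth r + 3)))) =
      real t * (real r * (real (sample_size \<epsilon> r t) * real (2 * search_depth r + 3)))" by simp
  also have "\<dots> \<le> real t * (real r * ((5 * sqrt (real r * L)) * (12 * L)))"
    using K k L r by (intro mult_left_mono mult_mono) auto
  also have "\<dots> = 60 * ((real r * sqrt (real r)) * real t * (L * sqrt L))"
    by (simp add: real_sqrt_mult)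
  also have "real r * sqrt (real r) = real r powr (3/2)"
    using r powr_add[of "real r" 1 "1/2"] by (simp add: powr_half_sqrt)
  also have "L * sqrt L = L powr (3/2)"
    using L powr_add[of L 1 "1/2"] by (simp add: powr_half_sqrt)
  finally show ?thesis by (simp add: L_def)
qed

section \<open>The complete algorithm\<close>

lemma sum_list_fun_apply:
  fixes g :: "'b \<Rightarrow> 'a \<Rightarrow> real"
  shows "(\<Sum>c\<leftarrow>cs. g c) v = (\<Sum>c\<leftarrow>cs. g c v)"
  by (induction cs) auto

text \<open>For \<open>\<epsilon> \<ge> 1\<close> and nonnegative \<open>f\<close> the value to be
  reached is at most zero, so any basis serves. The rank is read off the first basis without a
  query.\<close>

definition rounding_alg :: "real \<Rightarrow> (real \<times> 'a set) list \<Rightarrow> ('a, 'a set) oracle_alg" where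
  "rounding_alg \<epsilon> cs = (if 1 \<le> \<epsilon> then Return (snd (hd cs))
    else merge_all (sample_size \<epsilon> (card (snd (hd cs))) (length cs)) (search_depth (card (snd (hd cs))))
      (fst (hd cs)) (snd (hd cs)) (tl cs))"

text \<open>On the finitely many subsets of \<open>V\<close> the function is bounded, hence
  integrable, and the nonnegative integral equals the expectation.\<close>

lemma expect_le_expectation:
  assumes V: "finite V" and y: "yields orc m n (\<lambda>S. S \<subseteq> V)" and nonneg: "\<And>S. S \<subseteq> V \<Longrightarrow> 0 \<le> f S"
    and c: "0 \<le> c" "ennreal c \<le> expect orc m (\<lambda>S. ennreal (f S))"
  shows "c \<le> measure_pmf.expectation (run orc m) (\<lambda>(S, q). f S)"
proof -
  have yS: "fst z \<subseteq> V" if "z \<in> set_pmf (run orc m)" for z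
    using y that by (auto simp: yields_def case_prod_unfold)
  define b where "b = Max (f ` Pow V)"
  have b: "f S \<le> b" if "S \<subseteq> V" for S unfolding b_def using V that by (intro Max_ge) auto
  have "integrable (measure_pmf (run orc m)) (\<lambda>z. f (fst z))"
  proof (rule measure_pmf.integrable_const_bound)
    show "AE z in measure_pmf (run orc m). norm (f (fst z)) \<le> b"
      using yS nonneg b by (auto simp: AE_measure_pmf_iff)
  qed simp
  then have "expect orc m (\<lambda>S. ennreal (f S)) = ennreal (measure_pmf.expectation (run orc m) (\<lambda>z. f (fst z)))"
    unfolding expect_def using yS nonneg
    by (intro nn_integral_eq_integral) (auto simp: AE_measure_pmf_iff)
  moreover have "0 \<le> measure_pmf.expectation (run orc m) (\<lambda>z. f (fst z))"
    using yS nonneg by (intro integral_nonneg_AE) (auto simp: AE_measure_pmf_iff)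
  ultimately show ?thesis using c by (simp add: case_prod_unfold)
qed

text \<open>There are \<open>t - 1\<close> merges of at most \<open>r\<close> steps, each keeping a
  fraction \<open>1 - \<delta>\<close> of the expected value. Bernoulli's inequality bounds the
  product of these factors below by \<open>1 - \<epsilon>\<close>.\<close>

lemma rounding_alg_correct:
  assumes \<epsilon>: "0 < \<epsilon>" and M: "matroid V \<I>" and cs: "\<And>c. c \<in> set cs \<Longrightarrow> 0 \<le> fst c \<and> basis \<I> (snd c)"
    and sum: "(\<Sum>c\<leftarrow>cs. fst c) = 1"
  defines "r \<equiv> matroid_rank \<I>" and "t \<equiv> length cs"
  shows rounding_alg_yields: "yields (indep \<I>) (rounding_alg \<epsilon> cs)
      (if \<epsilon> < 1 then (t - 1) * (r * (sample_size \<epsilon> r t * (2 * search_depth r + 3))) else 0) (basis \<I>)"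
    and rounding_alg_expectation: "submodular_on V f \<Longrightarrow> (\<And>S. S \<subseteq> V \<Longrightarrow> 0 \<le> f S) \<Longrightarrow>
      (1 - \<epsilon>) * multilinear_extension V f (\<lambda>v. \<Sum>c\<leftarrow>cs. fst c * indicator (snd c) v)
      \<le> measure_pmf.expectation (run (indep \<I>) (rounding_alg \<epsilon> cs)) (\<lambda>(S, q). f S)"
proof -
  obtain b B cs' where cs_eq: "cs = (b, B) # cs'" using sum by (cases cs) auto
  have B: "basis \<I> B" "0 \<le> b" using cs[of "(b, B)"] cs_eq by auto
  have cs': "0 \<le> fst c \<and> basis \<I> (snd c)" if "c \<in> set cs'" for c using cs that cs_eq by auto
  have sum': "b + (\<Sum>c\<leftarrow>cs'. fst c) = 1" using sum cs_eq by simp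
  have rank: "card B' = r" if "basis \<I> B'" for B' using matroid_rank_eq_card[OF M that] by (simp add: r_def)
  have V: "finite V" using M by (simp add: matroid_def)
  have t: "1 \<le> t" "length cs' = t - 1" by (auto simp: t_def cs_eq)
  define \<delta> where "\<delta> = \<epsilon> / (real r * real t)"
  have alg: "rounding_alg \<epsilon> cs = merge_all (sample_size \<epsilon> r t) (search_depth r) b B cs'" if "\<epsilon> < 1"
    using that by (simp add: rounding_alg_def cs_eq rank[OF B(1)] t_def)
  have rounding: "rounding V \<I> f r (sample_size \<epsilon> r t) (search_depth r) \<delta>"
    if "\<epsilon> < 1" and f: "submodular_on V f" "\<And>S. S \<subseteq> V \<Longrightarrow> 0 \<le> f S" for f
  proof
    show "r \<le> 2 ^ search_depth r" by (rule search_depth_bound)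
    show "0 < sample_size \<epsilon> r t" by (simp add: sample_size_def)
    show "0 \<le> \<delta>" using \<epsilon> by (simp add: \<delta>_def)
    \<comment> \<open>For \<open>r = 0\<close> division by zero makes \<open>\<delta>\<close>
      zero.\<close>
    show "\<delta> \<le> 1"
    proof (cases "r = 0")
      case False
      then have "1 * 1 \<le> real r * real t" using t by (intro mult_mono) auto
      with that show ?thesis by (simp add: \<delta>_def divide_le_eq)
    qed (simp add: \<delta>_def)
    show "2 * real r * exp (- (real (sample_size \<epsilon> r t))\<^sup>2 / (2 * real r)) \<le> \<delta>"
    proof (cases "r = 0")
      case False
      then show ?thesis
        unfolding \<delta>_def using t \<epsilon> that(1) by (intro hitting_tail sample_size_bound) auto
    qed (simp add: \<delta>_def)
  qed (use M rank f in auto)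
  show yields: "yields (indep \<I>) (rounding_alg \<epsilon> cs)
      (if \<epsilon> < 1 then (t - 1) * (r * (sample_size \<epsilon> r t * (2 * search_depth r + 3))) else 0) (basis \<I>)"
  proof (cases "\<epsilon> < 1")
    case True
    \<comment> \<open>The query bound does not mention \<open>f\<close>, so the zero function
      instantiates the locale.\<close>
    have "rounding V \<I> (\<lambda>_. 0) r (sample_size \<epsilon> r t) (search_depth r) \<delta>"
      using True by (intro rounding) (auto simp: submodular_on_def)
    from rounding.merge_all_yields[OF this B cs' sum'] show ?thesis
      using True by (simp add: alg t(2))
  next
    case False
    then show ?thesis using B by (simp add: rounding_alg_def cs_eq yields_Return)
  qed
  show "(1 - \<epsilon>) * multilinear_extension V f (\<lambda>v. \<Sum>c\<leftarrow>cs. fst c * indicator (snd c) v)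
      \<le> measure_pmf.expectation (run (indep \<I>) (rounding_alg \<epsilon> cs)) (\<lambda>(S, q). f S)"
    if f: "submodular_on V f" "\<And>S. S \<subseteq> V \<Longrightarrow> 0 \<le> f S"
  proof -
    define x where "x v = (\<Sum>c\<leftarrow>cs. fst c * indicator (snd c) v)" for v
    have c0: "0 \<le> fst c" if "c \<in> set cs" for c using cs that by auto
    have "0 \<le> x v" for v
      unfolding x_def using c0 by (intro sum_list_nonneg) fastforce
    moreover have "x v \<le> (\<Sum>c\<leftarrow>cs. fst c)" for v
      unfolding x_def using c0 by (intro sum_list_mono) (auto simp: indicator_def)
    ultimately have F: "0 \<le> multilinear_extension V f x"
      using f(2) sum by (intro multilinear_extension_nonneg) auto
    show ?thesis
    proof (cases "\<epsilon> < 1")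
      case False
      then have "(1 - \<epsilon>) * multilinear_extension V f x \<le> 0" using F by (simp add: mult_nonpos_nonneg)
      also have "0 \<le> f B" using f(2) B(1) matroid_carrier[OF M basis_indep] by auto
      finally show ?thesis using False by (simp add: rounding_alg_def cs_eq x_def[abs_def])
    next
      case True
      interpret rounding V \<I> f r "sample_size \<epsilon> r t" "search_depth r" \<delta>
        using True f by (rule rounding)
      have "real ((t - 1) * r) * \<delta> \<le> \<epsilon>"
        using t(1) \<epsilon> by (cases "r = 0") (auto simp: \<delta>_def of_nat_diff field_simps)
      then have "1 - \<epsilon> \<le> (1 - \<delta>) ^ (length cs' * r)"
        using Bernoulli_inequality[of "- \<delta>" "(t - 1) * r"] \<delta> t(2) by simp
      then have "ennreal ((1 - \<epsilon>) * multilinear_extension V f x) \<le>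
          ennreal ((1 - \<delta>) ^ (length cs' * r) * multilinear_extension V f x)"
        using F by (intro ennreal_leI mult_right_mono)
      also have "\<dots> = ennreal ((1 - \<delta>) ^ (length cs' * r)) * ennreal (multilinear_extension V f x)"
        using F \<delta> by (intro ennreal_mult) auto
      also have "\<dots> \<le> expect (indep \<I>) (rounding_alg \<epsilon> cs) (\<lambda>S. ennreal (f S))"
        using merge_all_expect[OF B cs' sum'] by (simp add: alg[OF True, unfolded cs_eq] x_def[abs_def] cs_eq)
      finally show ?thesis
        unfolding x_def[symmetric, abs_def]
        using True F f(2) yields basis_carrier
        by (intro expect_le_expectation[OF V, where n = "if \<epsilon> < 1 then (t - 1) * (r * (sample_size \<epsilon> r t * (2 * search_depth r + 3))) else 0"])
          (auto elim!: yields_mono)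
    qed
  qed
qed

theorem theorem2:
  shows "\<exists>C::real. \<forall>\<epsilon>::real. \<epsilon> > 0 \<longrightarrow>
    (\<exists>alg :: 'a set \<Rightarrow> (real \<times> 'a set) list \<Rightarrow> ('a, 'a set) oracle_alg.
      \<forall>(V :: 'a set) (\<I> :: 'a set set) (cs :: (real \<times> 'a set) list) (x :: 'a \<Rightarrow> real) (r :: nat) (t :: nat).
        matroid V \<I> \<longrightarrow> r = matroid_rank \<I> \<longrightarrow> t = length cs \<longrightarrow>
        (\<forall>(\<beta>, B)\<in>set cs. 0 \<le> \<beta> \<and> basis \<I> B) \<longrightarrow>
        (\<Sum>(\<beta>, B)\<leftarrow>cs. \<beta>) = 1 \<longrightarrow>
        x \<in> base_polytope \<I> \<longrightarrow>
        x = (\<Sum>(\<beta>, B)\<leftarrow>cs. \<beta> *\<^sub>R indicator B) \<longrightarrow>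
        (\<forall>(S, q)\<in>set_pmf (run (\<lambda>S. S \<in> \<I>) (alg V cs)).
           basis \<I> S \<and>
           real q \<le> C * (real r powr (3/2) * real t * ln (real r * real t / \<epsilon>) powr (3/2))) \<and>
        (\<forall>f :: 'a set \<Rightarrow> real.
           submodular_on V f \<longrightarrow> (\<forall>S. S \<subseteq> V \<longrightarrow> 0 \<le> f S) \<longrightarrow>
           measure_pmf.expectation (run (\<lambda>S. S \<in> \<I>) (alg V cs)) (\<lambda>(S, q). f S)
             \<ge> (1 - \<epsilon>) * multilinear_extension V f x))"
proof (intro exI[of _ 60] allI impI)
  fix \<epsilon> :: real assume \<epsilon>: "\<epsilon> > 0"
  show "\<exists>alg :: 'a set \<Rightarrow> (real \<times> 'a set) list \<Rightarrow> ('a, 'a set) oracle_alg.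
      \<forall>(V :: 'a set) (\<I> :: 'a set set) (cs :: (real \<times> 'a set) list) (x :: 'a \<Rightarrow> real) (r :: nat) (t :: nat).
        matroid V \<I> \<longrightarrow> r = matroid_rank \<I> \<longrightarrow> t = length cs \<longrightarrow>
        (\<forall>(\<beta>, B)\<in>set cs. 0 \<le> \<beta> \<and> basis \<I> B) \<longrightarrow>
        (\<Sum>(\<beta>, B)\<leftarrow>cs. \<beta>) = 1 \<longrightarrow>
        x \<in> base_polytope \<I> \<longrightarrow>
        x = (\<Sum>(\<beta>, B)\<leftarrow>cs. \<beta> *\<^sub>R indicator B) \<longrightarrow>
        (\<forall>(S, q)\<in>set_pmf (run (\<lambda>S. S \<in> \<I>) (alg V cs)).
           basis \<I> S \<and>
           real q \<le> 60 * (real r powr (3/2) * real t * ln (real r * real t / \<epsilon>) powr (3/2))) \<and>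
        (\<forall>f :: 'a set \<Rightarrow> real.
           submodular_on V f \<longrightarrow> (\<forall>S. S \<subseteq> V \<longrightarrow> 0 \<le> f S) \<longrightarrow>
           measure_pmf.expectation (run (\<lambda>S. S \<in> \<I>) (alg V cs)) (\<lambda>(S, q). f S)
             \<ge> (1 - \<epsilon>) * multilinear_extension V f x)"
  proof (intro exI[of _ "\<lambda>_. rounding_alg \<epsilon>"] allI impI conjI)
    fix V :: "'a set" and \<I> :: "'a set set" and cs :: "(real \<times> 'a set) list"
      and x :: "'a \<Rightarrow> real" and r t :: nat
    assume M: "matroid V \<I>" and r: "r = matroid_rank \<I>" and t: "t = length cs"
      and "\<forall>(\<beta>, B)\<in>set cs. 0 \<le> \<beta> \<and> basis \<I> B" and "(\<Sum>(\<beta>, B)\<leftarrow>cs. \<beta>) = 1"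
      and x: "x = (\<Sum>(\<beta>, B)\<leftarrow>cs. \<beta> *\<^sub>R indicator B)"
    then have cs: "\<And>c. c \<in> set cs \<Longrightarrow> 0 \<le> fst c \<and> basis \<I> (snd c)"
      and sum: "(\<Sum>c\<leftarrow>cs. fst c) = 1"
      by (auto simp: case_prod_unfold)
    have x': "x = (\<lambda>v. \<Sum>c\<leftarrow>cs. fst c * indicator (snd c) v)"
      by (simp add: x fun_eq_iff sum_list_fun_apply case_prod_unfold scaleR_fun_def)
    let ?n = "if \<epsilon> < 1 then (t - 1) * (r * (sample_size \<epsilon> r t * (2 * search_depth r + 3))) else 0"
    have n: "real ?n \<le> 60 * (real r powr (3/2) * real t * ln (real r * real t / \<epsilon>) powr (3/2))"
    proof (cases "\<epsilon> < 1 \<and> 1 \<le> r \<and> 2 \<le> t")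
      case True
      then have "real ?n \<le> real (t * (r * (sample_size \<epsilon> r t * (2 * search_depth r + 3))))"
        unfolding of_nat_le_iff by (auto intro!: mult_le_mono1)
      also have "\<dots> \<le> 60 * (real r powr (3/2) * real t * ln (real r * real t / \<epsilon>) powr (3/2))"
        using True \<epsilon> by (intro query_count_bound) auto
      finally show ?thesis .
    next
      case False
      \<comment> \<open>No query is made for \<open>\<epsilon> \<ge> 1\<close>, rank 0 or a single
        basis, where the logarithm may be too small to absorb constants.\<close>
      then have "?n = 0" by auto
      then show ?thesis by simp
    qed
    show "\<forall>(S, q)\<in>set_pmf (run (\<lambda>S. S \<in> \<I>) (rounding_alg \<epsilon> cs)).
        basis \<I> S \<and> real q \<le> 60 * (real r powr (3/2) * real t * ln (real r * real t / \<epsilon>) powr (3/2))"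
      using rounding_alg_yields[OF \<epsilon> M cs sum] n unfolding yields_def r t by fastforce
    show "(1 - \<epsilon>) * multilinear_extension V f x \<le>
        measure_pmf.expectation (run (\<lambda>S. S \<in> \<I>) (rounding_alg \<epsilon> cs)) (\<lambda>(S, q). f S)"
      if "submodular_on V f" "\<forall>S. S \<subseteq> V \<longrightarrow> 0 \<le> f S" for f
      unfolding x' using that by (intro rounding_alg_expectation[OF \<epsilon> M cs sum]) auto
  qed
qed

end
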